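(* Let $\mathbf{A}$ be the multiparametric quon algebra over $\mathbb{C}[q_{i,j}]$ acting on $\mathbf{V}$ with vacuum $|0\rangle$, and let $\mathbf{H} := \{\mathtt{a}|0\rangle \mid \mathtt{a} \in \mathbf{A}\}$. Assume $|q_{i,j}| < 1$ for all $i,j \in \mathbb{N}^*$. Then $\mathbf{H}$ is an indefinite Hilbert module for the map $(.,.): \mathbf{H} \times \mathbf{H} \rightarrow \mathbb{C}[q_{i,j}]$ defined, for $\mu,\nu \in \mathbb{C}[q_{i,j}]$ and $\mathtt{a},\mathtt{b} \in \mathbf{A}$, by $$\big(\mu\mathtt{a}|0\rangle,\, \nu\mathtt{b}|0\rangle\big) := \mu\tilde{\nu}\, \langle 0|\mathtt{a}\,\mathtt{b}^{\dag}|0\rangle, \qquad \langle 0|0\rangle = 1,$$ where the bra-ket $\langle 0|\mathtt{a}\,\mathtt{b}^{\dag}|0\rangle$ is evaluated using the defining relations of $\mathbf{A}$.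
   Context: $\mathbb{C}[q_{i,j}]$ denotes the polynomial ring $\mathbb{C}[q_{i,j} \mid i,j \in \mathbb{N}^*]$ ($\mathbb{N}^*$ = positive integers). The multiparametric quon algebra $\mathbf{A}$ is the free algebra $\mathbb{C}[q_{i,j}][\mathtt{a}_i \mid i \in \mathbb{N}^*]$ equipped with an anti-involution $\dag$ exchanging $\mathtt{a}_i$ and $\mathtt{a}_i^{\dag}$, subject to $\mathtt{a}_i\mathtt{a}_j^{\dag} = q_{i,j}\,\mathtt{a}_j^{\dag}\mathtt{a}_i + \delta_{i,j}$. In a Fock-like representation the $\mathtt{a}_i,\mathtt{a}_i^{\dag}$ are linear operators on an infinite-dimensional $\mathbb{C}[q_{i,j}]$-module $\mathbf{V}$ satisfying these relations, $\mathtt{a}_i^{\dag}$ is the adjoint of $\mathtt{a}_i$, and $\mathtt{a}_i|0\rangle = 0$ for a distinguished nonzero vector $|0\rangle$ (hence $\langle 0|\mathtt{a}_i^{\dag} = 0$). The $q_{i,j}$-conjugate of a monomial $P = \mu\prod_{u} q_{i_u,j_u}$ ($\mu\in\mathbb{C}$) is $\tilde{P} = \bar{\mu}\prod_u q_{j_u,i_u}$, extended additively to polynomials. An indefinite inner product on a module $\mathbf{V}$ is a map $(.,.):\mathbf{V}\times\mathbf{V}\to\mathbb{C}[q_{i,j}]$ such that for $\mu\in\mathbb{C}$ and $\mathtt{u},\mathtt{v},\mathtt{w}\in\mathbf{V}$: $(\mu\mathtt{u},\mathtt{v}) = \mu(\mathtt{u},\mathtt{v})$, $(\mathtt{u}+\mathtt{v},\mathtt{w})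 = (\mathtt{u},\mathtt{w})+(\mathtt{v},\mathtt{w})$, $(\mathtt{u},\mathtt{v}) = \widetilde{(\mathtt{v},\mathtt{u})}$, and $(\mathtt{u},\mathtt{u}) \neq 0$ whenever $\mathtt{u}\neq 0$. An indefinite Hilbert module means a module equipped with such an indefinite inner product.
   Formalization: The bra-ket is taken as ⟨0|b†a|0⟩, since ⟨0|ab†|0⟩ is not well defined on H (a=b=a_1 gives 1 for the zero vector); |q_ij|<1 is read as a condition on numerical values, used only for an added claim on specialising at values with q_ji = conj(q_ij). *)

theory Defs
  imports "HOL-Library.Poly_Mapping" "HOL.Complex" "HOL.Modules"
begin

section \<open>The coefficient ring\<close>

text \<open>
  The positive integers are the type \<^typ>\<open>num\<close> of the HOL library. Polynomials are monoid
  algebras: a monomial is a finitely supported exponent function on pairs of indices.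
\<close>

type_synonym monom = "(num \<times> num) \<Rightarrow>\<^sub>0 nat"
type_synonym coeff = "monom \<Rightarrow>\<^sub>0 complex"

definition qvar :: "num \<Rightarrow> num \<Rightarrow> coeff" where
  "qvar i j = Poly_Mapping.single (Poly_Mapping.single (i, j) 1) 1"

definition const_poly :: "complex \<Rightarrow> coeff" where
  "const_poly c = Poly_Mapping.single 0 c"

definition swap_monom :: "monom \<Rightarrow> monom" where
  "swap_monom m = Poly_Mapping.map_key prod.swap m"

text \<open>
  The conjugate of a polynomial: complex conjugation on coefficients, transposition of the
  indices of every indeterminate (see \<open>qconj_single\<close>, \<open>qconj_qvar\<close>, \<open>qconj_mult\<close> below).
\<close>

definition qconj :: "coeff \<Rightarrow> coeff" where
  "qconj p = Poly_Mapping.map_key swap_monom (Poly_Mapping.map cnj p)"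

definition poly_at :: "(num \<Rightarrow> num \<Rightarrow> complex) \<Rightarrow> coeff \<Rightarrow> complex" where
  "poly_at q p = (\<Sum>m\<in>Poly_Mapping.keys p. Poly_Mapping.lookup p m *
     (\<Prod>ij\<in>Poly_Mapping.keys m. q (fst ij) (snd ij) ^ Poly_Mapping.lookup m ij))"

lemma inj_swap [simp]: "inj (prod.swap :: 'a \<times> 'a \<Rightarrow> 'a \<times> 'a)"
  by (auto simp: inj_def)

lemma lookup_swap_monom: "Poly_Mapping.lookup (swap_monom m) (i, j) = Poly_Mapping.lookup m (j, i)"
  by (simp add: swap_monom_def map_key.rep_eq)

lemma swap_monom_swap [simp]: "swap_monom (swap_monom m) = m"
  by (rule poly_mapping_eqI) (auto simp: lookup_swap_monom)

lemma inj_swap_monom [simp]: "inj swap_monom"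
  by (metis injI swap_monom_swap)

lemma swap_monom_add: "swap_monom (m + n) = swap_monom m + swap_monom n"
  by (rule poly_mapping_eqI) (auto simp: lookup_swap_monom lookup_add)

lemma swap_monom_zero [simp]: "swap_monom 0 = 0"
  by (simp add: swap_monom_def)

lemma swap_monom_single [simp]:
  "swap_monom (Poly_Mapping.single (i, j) n) = Poly_Mapping.single (j, i) n"
  by (rule poly_mapping_eqI) (auto simp: lookup_swap_monom lookup_single when_def split: if_splits)

lemma poly_mapping_add_induct [case_names single add]:
  assumes single: "\<And>k v. P (Poly_Mapping.single k v)"
    and add: "\<And>p q. P p \<Longrightarrow> P q \<Longrightarrow> P (p + q)"
  shows "P (p :: 'a \<Rightarrow>\<^sub>0 'b::comm_monoid_add)"
proof (induction p rule: update_induct)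
  case const
  have "P (Poly_Mapping.single undefined 0)" by (rule single)
  then show ?case by simp
next
  case (update f a b)
  have "Poly_Mapping.update a b f = f + Poly_Mapping.single a b"
    using update.hyps
    by (intro poly_mapping_eqI)
      (auto simp: lookup_update lookup_add lookup_single when_def in_keys_iff)
  then show ?case using update single add by simp
qed

lemma lookup_qconj:
  "Poly_Mapping.lookup (qconj p) m = cnj (Poly_Mapping.lookup p (swap_monom m))"
  by (simp add: qconj_def map_key.rep_eq Poly_Mapping.map.rep_eq when_def)

lemma qconj_add: "qconj (p + r) = qconj p + qconj r"
  by (rule poly_mapping_eqI) (auto simp: lookup_qconj lookup_add)

lemma qconj_zero [simp]: "qconj 0 = 0"
  by (rule poly_mapping_eqI) (auto simp: lookup_qconj)

lemma qconj_qconj [simp]: "qconj (qconj p) = p"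
  by (rule poly_mapping_eqI) (auto simp: lookup_qconj)

lemma qconj_single:
  "qconj (Poly_Mapping.single m c) = Poly_Mapping.single (swap_monom m) (cnj c)"
  by (rule poly_mapping_eqI) (auto simp: lookup_qconj lookup_single when_def)

lemma qconj_qvar [simp]: "qconj (qvar i j) = qvar j i"
  by (simp add: qvar_def qconj_single)

lemma qconj_mult: "qconj (p * r) = qconj p * qconj r"
proof (induction p rule: poly_mapping_add_induct)
  case (single k v)
  show ?case
    by (induction r rule: poly_mapping_add_induct)
      (simp_all add: mult_single qconj_single swap_monom_add qconj_add distrib_left)
qed (simp add: qconj_add distrib_right)

lemma qconj_one [simp]: "qconj 1 = 1"
  using qconj_single[of 0 1] by simp


section \<open>The free algebra\<close>

datatype letter = Ann num | Cre num

text \<open>Words form a monoid, written additively because that is what monoid algebras expect.\<close>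

datatype word = Word (letters: "letter list")

instantiation word :: monoid_add
begin

definition zero_word :: word where "0 = Word []"
definition plus_word :: "word \<Rightarrow> word \<Rightarrow> word" where "v + w = Word (letters v @ letters w)"

instance by standard (auto simp: zero_word_def plus_word_def)

end

type_synonym free_alg = "word \<Rightarrow>\<^sub>0 coeff"

definition fgen :: "letter \<Rightarrow> free_alg" where
  "fgen x = Poly_Mapping.single (Word [x]) 1"

definition fscal :: "coeff \<Rightarrow> free_alg" where
  "fscal c = Poly_Mapping.single 0 c"

fun dag_letter :: "letter \<Rightarrow> letter" where
  "dag_letter (Ann i) = Cre i"
| "dag_letter (Cre i) = Ann i"

definition dag_word :: "word \<Rightarrow> word" where
  "dag_word w = Word (rev (map dag_letter (letters w)))"

text \<open>
  The anti-involution acts on coefficients by conjugation. This is forced: the adjoint of the relation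
  for \<open>(i, j)\<close> has to be the relation for \<open>(j, i)\<close>.
\<close>

definition fdag :: "free_alg \<Rightarrow> free_alg" where
  "fdag x = Poly_Mapping.map_key dag_word (Poly_Mapping.map qconj x)"

definition frel :: "num \<Rightarrow> num \<Rightarrow> free_alg" where
  "frel i j = fgen (Ann i) * fgen (Cre j)
     - (fscal (qvar i j) * (fgen (Cre j) * fgen (Ann i)) + (if i = j then 1 else 0))"

inductive_set quon_ideal :: "free_alg set" where
  zero: "0 \<in> quon_ideal"
| gen: "x * frel i j * y \<in> quon_ideal"
| add: "x \<in> quon_ideal \<Longrightarrow> y \<in> quon_ideal \<Longrightarrow> x + y \<in> quon_ideal"

lemma dag_letter_dag [simp]: "dag_letter (dag_letter x) = x"
  by (cases x) auto

lemma dag_word_dag [simp]: "dag_word (dag_word w) = w"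
  by (cases w) (simp add: dag_word_def rev_map comp_def)

lemma inj_dag_word [simp]: "inj dag_word"
  by (metis injI dag_word_dag)

lemma dag_word_add: "dag_word (v + w) = dag_word w + dag_word v"
  by (simp add: dag_word_def plus_word_def)

lemma dag_word_zero [simp]: "dag_word 0 = 0"
  by (simp add: dag_word_def zero_word_def)

lemma lookup_fdag:
  "Poly_Mapping.lookup (fdag x) w = qconj (Poly_Mapping.lookup x (dag_word w))"
  by (simp add: fdag_def map_key.rep_eq Poly_Mapping.map.rep_eq when_def)

lemma fdag_add: "fdag (x + y) = fdag x + fdag y"
  by (rule poly_mapping_eqI) (auto simp: lookup_fdag lookup_add qconj_add)

lemma fdag_zero [simp]: "fdag 0 = 0"
  by (rule poly_mapping_eqI) (auto simp: lookup_fdag)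

lemma fdag_uminus: "fdag (- x) = - fdag x"
proof -
  have "fdag (- x) + fdag x = 0" by (simp flip: fdag_add)
  then show ?thesis by (simp add: eq_neg_iff_add_eq_0)
qed

lemma fdag_diff: "fdag (x - y) = fdag x - fdag y"
  using fdag_add[of x "- y"] by (simp add: fdag_uminus)

lemma fdag_single:
  "fdag (Poly_Mapping.single w c) = Poly_Mapping.single (dag_word w) (qconj c)"
  by (rule poly_mapping_eqI) (auto simp: lookup_fdag lookup_single when_def)

lemma fdag_mult: "fdag (x * y) = fdag y * fdag x"
proof (induction x rule: poly_mapping_add_induct)
  case (single k v)
  show ?case
    by (induction y rule: poly_mapping_add_induct)
      (simp_all add: mult_single fdag_single dag_word_add qconj_mult mult.commute
        fdag_add distrib_left distrib_right)
qed (simp add: fdag_add distrib_left distrib_right)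

lemma fdag_fdag [simp]: "fdag (fdag x) = x"
  by (rule poly_mapping_eqI) (auto simp: lookup_fdag)

lemma fdag_fgen [simp]: "fdag (fgen x) = fgen (dag_letter x)"
  by (simp add: fgen_def fdag_single dag_word_def)

lemma fdag_fscal [simp]: "fdag (fscal c) = fscal (qconj c)"
  by (simp add: fscal_def fdag_single)

lemma fdag_one [simp]: "fdag 1 = 1"
  using fdag_fscal[of 1] by (simp add: fscal_def)

lemma fscal_central: "fscal c * x = x * fscal c"
  by (induction x rule: poly_mapping_add_induct)
    (simp_all add: fscal_def mult_single mult.commute distrib_left distrib_right)

lemma fdag_frel: "fdag (frel i j) = frel j i"
  by (simp add: frel_def fdag_diff fdag_add fdag_mult flip: fscal_central)

lemma quon_ideal_uminus: "x \<in> quon_ideal \<Longrightarrow> - x \<in> quon_ideal"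
proof (induction rule: quon_ideal.induct)
  case (gen x i j y)
  show ?case using quon_ideal.gen[of "- x" i j y] by simp
next
  case (add x y)
  then show ?case using quon_ideal.add[of "- x" "- y"] by (simp add: algebra_simps)
qed (simp add: quon_ideal.zero)

lemma quon_ideal_diff: "x \<in> quon_ideal \<Longrightarrow> y \<in> quon_ideal \<Longrightarrow> x - y \<in> quon_ideal"
  using quon_ideal.add[of x "- y"] quon_ideal_uminus by simp

lemma quon_ideal_mult_left: "x \<in> quon_ideal \<Longrightarrow> z * x \<in> quon_ideal"
proof (induction rule: quon_ideal.induct)
  case (gen x i j y)
  show ?case using quon_ideal.gen[of "z * x" i j y] by (simp add: mult.assoc)
qed (simp_all add: quon_ideal.zero quon_ideal.add distrib_left)

lemma quon_ideal_mult_right: "x \<in> quon_ideal \<Longrightarrow> x * z \<in> quon_ideal"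
proof (induction rule: quon_ideal.induct)
  case (gen x i j y)
  show ?case using quon_ideal.gen[of x i j "y * z"] by (simp add: mult.assoc)
qed (simp_all add: quon_ideal.zero quon_ideal.add distrib_right)

lemma quon_ideal_fdag: "x \<in> quon_ideal \<Longrightarrow> fdag x \<in> quon_ideal"
proof (induction rule: quon_ideal.induct)
  case (gen x i j y)
  show ?case using quon_ideal.gen[of "fdag y" j i "fdag x"]
    by (simp add: fdag_mult fdag_frel mult.assoc)
qed (simp_all add: quon_ideal.zero quon_ideal.add fdag_add)


section \<open>The multiparametric quon algebra\<close>

definition quon_rel :: "free_alg \<Rightarrow> free_alg \<Rightarrow> bool" where
  "quon_rel x y \<longleftrightarrow> x - y \<in> quon_ideal"

quotient_type quon = free_alg / quon_rel
proof (rule equivpI)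
  show "reflp quon_rel"
    by (rule reflpI) (simp add: quon_rel_def quon_ideal.zero)
  show "symp quon_rel"
    unfolding symp_def quon_rel_def using quon_ideal_uminus by fastforce
  show "transp quon_rel"
    unfolding transp_def quon_rel_def using quon_ideal.add by fastforce
qed

text \<open>Class \<open>ring_1\<close> would additionally require \<open>0 \<noteq> 1\<close>.\<close>

instantiation quon :: "{ring, monoid_mult}"
begin

lift_definition zero_quon :: quon is 0 .
lift_definition one_quon :: quon is 1 .
lift_definition plus_quon :: "quon \<Rightarrow> quon \<Rightarrow> quon" is "(+)"
  unfolding quon_rel_def by (simp only: add_diff_add quon_ideal.add)
lift_definition uminus_quon :: "quon \<Rightarrow> quon" is uminus
  unfolding quon_rel_def by (simp only: minus_diff_minus quon_ideal_uminus)
lift_definition minus_quon :: "quon \<Rightarrow> quon \<Rightarrow> quon" is "(-)"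
proof -
  fix x x' y y' :: free_alg
  assume "quon_rel x x'" "quon_rel y y'"
  moreover have "x - y - (x' - y') = (x - x') - (y - y')"
    by simp
  ultimately show "quon_rel (x - y) (x' - y')"
    unfolding quon_rel_def by (simp only: quon_ideal_diff)
qed
lift_definition times_quon :: "quon \<Rightarrow> quon \<Rightarrow> quon" is "(*)"
proof -
  fix x x' y y' :: free_alg
  assume "quon_rel x x'" "quon_rel y y'"
  moreover have "x * y - x' * y' = (x - x') * y + x' * (y - y')"
    by (simp add: algebra_simps)
  ultimately show "quon_rel (x * y) (x' * y')"
    unfolding quon_rel_def
    by (simp add: quon_ideal.add quon_ideal_mult_left quon_ideal_mult_right)
qed

instance
  by standard (transfer; simp add: quon_rel_def quon_ideal.zero algebra_simps)+

end

lift_definition ann :: "num \<Rightarrow> quon" is "\<lambda>i. fgen (Ann i)" .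
lift_definition cre :: "num \<Rightarrow> quon" is "\<lambda>i. fgen (Cre i)" .
lift_definition scal :: "coeff \<Rightarrow> quon" is fscal .
lift_definition dag :: "quon \<Rightarrow> quon" is fdag
  unfolding quon_rel_def by (simp only: quon_ideal_fdag flip: fdag_diff)

lemma quon_relation:
  "ann i * cre j = scal (qvar i j) * (cre j * ann i) + (if i = j then 1 else 0)"
proof -
  have "quon_rel (fgen (Ann i) * fgen (Cre j))
      (fscal (qvar i j) * (fgen (Cre j) * fgen (Ann i)) + (if i = j then 1 else 0))"
    using quon_ideal.gen[of 1 i j 1] by (simp add: quon_rel_def frel_def)
  then have "ann i * cre j = abs_quon
      (fscal (qvar i j) * (fgen (Cre j) * fgen (Ann i)) + (if i = j then 1 else 0))"
    by (simp add: ann.abs_eq cre.abs_eq times_quon.abs_eq quon.abs_eq_iff)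
  also have "\<dots> = scal (qvar i j) * (cre j * ann i) + (if i = j then 1 else 0)"
    by (simp add: ann.abs_eq cre.abs_eq scal.abs_eq times_quon.abs_eq plus_quon.abs_eq
        one_quon_def zero_quon_def)
  finally show ?thesis .
qed

lemma dag_ann: "dag (ann i) = cre i"
  and dag_cre: "dag (cre i) = ann i"
  and dag_scal: "dag (scal c) = scal (qconj c)"
  and dag_mult: "dag (x * y) = dag y * dag x"
  and dag_add: "dag (x + y) = dag x + dag y"
  and dag_dag: "dag (dag x) = x"
  by (transfer; simp add: quon_rel_def quon_ideal.zero fdag_mult fdag_add)+


section \<open>Vacuum expectation\<close>

text \<open>
  The bra-ket of \<open>x\<close> is the scalar to which \<open>x\<close> reduces modulo the terms killed by
  \<open>a\<^sub>i |0\<rangle> = 0\<close> on the right and by \<open>\<langle>0| a\<^sub>i\<^sup>\<dagger> = 0\<close> on the left, with \<open>\<langle>0|0\<rangle> = 1\<close>.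
\<close>

inductive_set vac_null :: "quon set" where
  zero: "0 \<in> vac_null"
| left: "cre i * x \<in> vac_null"
| right: "x * ann i \<in> vac_null"
| add: "x \<in> vac_null \<Longrightarrow> y \<in> vac_null \<Longrightarrow> x + y \<in> vac_null"

definition braket :: "quon \<Rightarrow> coeff" where
  "braket x = (THE c. x - scal c \<in> vac_null)"


section \<open>Fock-like representations\<close>

text \<open>
  The pairing \<open>pair\<close> is the one with respect to which \<open>a\<^sub>i\<^sup>\<dagger>\<close> is the adjoint of \<open>a\<^sub>i\<close>. It is
  sesquilinear and normalised at the vacuum; neither definiteness nor nondegeneracy is
  assumed of it.
\<close>

locale fock_representation = module scale
  for scale :: "coeff \<Rightarrow> 'v::ab_group_add \<Rightarrow> 'v" +
  fixes act :: "quon \<Rightarrow> 'v \<Rightarrow> 'v"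
    and pair :: "'v \<Rightarrow> 'v \<Rightarrow> coeff"
    and vac :: 'v
  assumes infinite_dim: "\<nexists>B. finite B \<and> span B = UNIV"
    and act_add_right: "act x (u + v) = act x u + act x v"
    and act_add_left: "act (x + y) v = act x v + act y v"
    and act_mult: "act (x * y) v = act x (act y v)"
    and act_scal: "act (scal c) v = scale c v"
    and pair_add: "pair (u + v) w = pair u w + pair v w"
    and pair_scale: "pair (scale c u) v = c * pair u v"
    and pair_conj: "pair u v = qconj (pair v u)"
    and adjoint: "pair (act (ann i) u) v = pair u (act (cre i) v)"
    and vac_nonzero: "vac \<noteq> 0"
    and ann_vac: "act (ann i) vac = 0"
    and pair_vac: "pair vac vac = 1"


section \<open>Indefinite Hilbert modules\<close>

definition indefinite_inner_product ::
  "(coeff \<Rightarrow> 'v::ab_group_add \<Rightarrow> 'v) \<Rightarrow> 'v set \<Rightarrow> ('v \<Rightarrow> 'v \<Rightarrow> coeff) \<Rightarrow> bool" where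
  "indefinite_inner_product scale H ip \<longleftrightarrow>
     (\<forall>c. \<forall>u\<in>H. \<forall>v\<in>H. ip (scale (const_poly c) u) v = const_poly c * ip u v) \<and>
     (\<forall>u\<in>H. \<forall>v\<in>H. \<forall>w\<in>H. ip (u + v) w = ip u w + ip v w) \<and>
     (\<forall>u\<in>H. \<forall>v\<in>H. ip u v = qconj (ip v u)) \<and>
     (\<forall>u\<in>H. u \<noteq> 0 \<longrightarrow> ip u u \<noteq> 0)"

definition indefinite_hilbert_module ::
  "(coeff \<Rightarrow> 'v::ab_group_add \<Rightarrow> 'v) \<Rightarrow> 'v set \<Rightarrow> ('v \<Rightarrow> 'v \<Rightarrow> coeff) \<Rightarrow> bool" where
  "indefinite_hilbert_module scale H ip \<longleftrightarrow>
     module scale \<and> module.subspace scale H \<and> indefinite_inner_product scale H ip"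

text \<open>
  The elements of \<open>H\<close> that become zero when the indeterminates are given the values \<open>q i j\<close>,
  i.e. \<open>I H\<close> with \<open>I\<close> the ideal of polynomials vanishing at \<open>q\<close>. Specialising at \<open>q\<close> turns
  \<^const>\<open>qconj\<close> into complex conjugation exactly when \<open>q j i\<close> is the complex conjugate of
  \<open>q i j\<close> for all \<open>i\<close>, \<open>j\<close>; only then does a sesquilinear form on \<open>H\<close> induce one on \<open>H / I H\<close>.
\<close>

definition zero_at ::
  "(coeff \<Rightarrow> 'v::ab_group_add \<Rightarrow> 'v) \<Rightarrow> 'v set \<Rightarrow> (num \<Rightarrow> num \<Rightarrow> complex) \<Rightarrow> 'v set" where
  "zero_at scale H q = module.span scale {scale p u | p u. u \<in> H \<and> poly_at q p = 0}"

end

theory Submission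
  imports Defs Complex_Main
begin

text \<open>
  Normal ordering shows that the bra-ket of \<open>x\<close> is \<open>(x|0\<rangle>, |0\<rangle>)\<close> for the pairing of the
  representation, so the form is that pairing. On the words \<open>|w\<rangle>\<close> in the creation
  operators it has a Gram matrix \<open>G\<close> that sums weights of permutations. At a Hermitian point \<open>q\<close>
  with all \<open>|q\<^sub>i\<^sub>j| < 1\<close> the matrix \<open>G\<close> is a product of sums of
  braided cycles, and Zagier's factorisation shows that these are invertible. Since this also
  holds along the segment from \<open>0\<close> to \<open>q\<close> and \<open>G = 1\<close> at \<open>0\<close>, the matrix is positive definite at
  \<open>q\<close>. Finally, a polynomial that vanishes at all these Hermitian points is zero, because
  distinct monomials are distinct, hence linearly independent, characters on them.
\<close>

section \<open>Evaluation of polynomials\<close>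

text \<open>Split off from \<open>poly_at\<close> because it is multiplicative twice: in the
  monomial, which makes \<open>poly_at q\<close> a ring homomorphism, and in the point, which makes
  every monomial a character.\<close>

definition monom_at :: "(num \<Rightarrow> num \<Rightarrow> complex) \<Rightarrow> monom \<Rightarrow> complex" where
  "monom_at q m = (\<Prod>ij\<in>Poly_Mapping.keys m. q (fst ij) (snd ij) ^ Poly_Mapping.lookup m ij)"

lemma monom_at_superset:
  assumes "finite A" "Poly_Mapping.keys m \<subseteq> A"
  shows "monom_at q m = (\<Prod>ij\<in>A. q (fst ij) (snd ij) ^ Poly_Mapping.lookup m ij)"
  unfolding monom_at_def
  by (rule prod.mono_neutral_left) (use assms in \<open>auto simp: in_keys_iff\<close>)

lemma monom_at_zero [simp]: "monom_at q 0 = 1"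
  by (simp add: monom_at_def)

lemma monom_at_add: "monom_at q (m + n) = monom_at q m * monom_at q n"
proof -
  let ?A = "Poly_Mapping.keys m \<union> Poly_Mapping.keys n"
  have "Poly_Mapping.keys (m + n) \<subseteq> ?A" by (rule keys_add)
  then show ?thesis
    by (simp add: monom_at_superset[of ?A] lookup_add power_add prod.distrib)
qed

lemma monom_at_mult: "monom_at (\<lambda>i j. q i j * r i j) m = monom_at q m * monom_at r m"
  by (simp add: monom_at_def power_mult_distrib prod.distrib)

lemma monom_at_nonzero:
  assumes "\<And>i j. q i j \<noteq> 0" shows "monom_at q m \<noteq> 0"
  by (simp add: monom_at_def assms)

lemma monom_at_swap: "monom_at q (swap_monom m) = monom_at (\<lambda>i j. q j i) m"
proof -
  have "Poly_Mapping.keys (swap_monom m) = prod.swap ` Poly_Mapping.keys m"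
    by (force simp: in_keys_iff lookup_swap_monom image_iff)
  moreover have "Poly_Mapping.lookup (swap_monom m) (prod.swap ij) = Poly_Mapping.lookup m ij" for ij
    by (cases ij) (simp add: lookup_swap_monom)
  ultimately show ?thesis
    by (simp add: monom_at_def prod.reindex inj_on_subset[OF inj_swap])
qed

lemma poly_at_superset:
  assumes "finite A" "Poly_Mapping.keys p \<subseteq> A"
  shows "poly_at q p = (\<Sum>m\<in>A. Poly_Mapping.lookup p m * monom_at q m)"
  unfolding poly_at_def monom_at_def
  by (rule sum.mono_neutral_left) (use assms in \<open>auto simp: in_keys_iff\<close>)

lemma poly_at_zero [simp]: "poly_at q 0 = 0"
  by (simp add: poly_at_def)

lemma poly_at_single [simp]: "poly_at q (Poly_Mapping.single m c) = c * monom_at q m"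
  by (simp add: poly_at_superset[of "{m}"])

lemma poly_at_one [simp]: "poly_at q 1 = 1"
  using poly_at_single[of q 0 1] by simp

lemma poly_at_qvar [simp]: "poly_at q (qvar i j) = q i j"
  by (simp add: qvar_def monom_at_def)

lemma poly_at_add: "poly_at q (p + r) = poly_at q p + poly_at q r"
proof -
  let ?A = "Poly_Mapping.keys p \<union> Poly_Mapping.keys r"
  have "Poly_Mapping.keys (p + r) \<subseteq> ?A" by (rule keys_add)
  then show ?thesis
    by (simp add: poly_at_superset[of ?A] lookup_add distrib_right sum.distrib)
qed

lemma poly_at_mult: "poly_at q (p * r) = poly_at q p * poly_at q r"
proof (induction p rule: poly_mapping_add_induct)
  case (single k v)
  show ?case
    by (induction r rule: poly_mapping_add_induct)
      (simp_all add: mult_single monom_at_add poly_at_add distrib_left)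
qed (simp add: poly_at_add distrib_right)

lemma poly_at_sum: "poly_at q (\<Sum>k\<in>K. p k) = (\<Sum>k\<in>K. poly_at q (p k))"
  by (induction K rule: infinite_finite_induct) (simp_all add: poly_at_add)

lemma poly_at_qconj:
  assumes "\<And>i j. q j i = cnj (q i j)"
  shows "poly_at q (qconj p) = cnj (poly_at q p)"
proof (induction p rule: poly_mapping_add_induct)
  case (single m c)
  have "monom_at (\<lambda>i j. q j i) m = cnj (monom_at q m)"
    by (simp add: monom_at_def flip: assms)
  then show ?case by (simp add: qconj_single monom_at_swap)
qed (simp add: qconj_add poly_at_add)

text \<open>Artin's induction: translating the relation by \<open>y\<close> and subtracting a multiple of it removes one character.\<close>

lemma characters_independent:
  fixes \<chi> :: "'k \<Rightarrow> 'm \<Rightarrow> 'f::field"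
  assumes "finite K"
    and closed: "\<And>x y. x \<in> S \<Longrightarrow> y \<in> S \<Longrightarrow> f x y \<in> S"
    and mult: "\<And>k x y. x \<in> S \<Longrightarrow> y \<in> S \<Longrightarrow> \<chi> k (f x y) = \<chi> k x * \<chi> k y"
    and nonzero: "\<And>k. \<exists>x\<in>S. \<chi> k x \<noteq> 0"
    and distinct: "\<And>k l. k \<noteq> l \<Longrightarrow> \<exists>x\<in>S. \<chi> k x \<noteq> \<chi> l x"
    and relation: "\<And>x. x \<in> S \<Longrightarrow> (\<Sum>k\<in>K. c k * \<chi> k x) = 0"
    and "k \<in> K"
  shows "c k = 0"
  using \<open>finite K\<close> relation \<open>k \<in> K\<close>
proof (induction K arbitrary: c k rule: finite_induct)
  case (insert l K)
  have zero: "c i = 0" if "i \<in> K" for i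
  proof -
    have "i \<noteq> l" using that insert.hyps(2) by blast
    then obtain y where y: "y \<in> S" "\<chi> i y \<noteq> \<chi> l y"
      using distinct[of i l] by blast
    have "(\<Sum>j\<in>K. (c j * (\<chi> j y - \<chi> l y)) * \<chi> j x) = 0" if x: "x \<in> S" for x
    proof -
      \<comment> \<open>The summand at \<open>l\<close> carries the factor
        \<open>\<chi> l y - \<chi> l y\<close>, so adding it changes nothing.\<close>
      have "(\<Sum>j\<in>K. (c j * (\<chi> j y - \<chi> l y)) * \<chi> j x)
          = (\<Sum>j\<in>insert l K. (c j * (\<chi> j y - \<chi> l y)) * \<chi> j x)"
        using insert.hyps by simp
      also have "\<dots> = (\<Sum>j\<in>insert l K. c j * \<chi> j (f y x)) - \<chi> l y * (\<Sum>j\<in>insert l K. c j * \<chi> j x)"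
        by (simp add: mult x y sum_distrib_left sum_subtractf[symmetric] algebra_simps
            del: sum.insert)
      also have "\<dots> = 0"
        using insert.prems(1)[OF closed[OF y(1) x]] insert.prems(1)[OF x] by simp
      finally show ?thesis .
    qed
    then have "c i * (\<chi> i y - \<chi> l y) = 0" by (rule insert.IH) (use that in auto)
    then show ?thesis using y by simp
  qed
  obtain x where x: "x \<in> S" "\<chi> l x \<noteq> 0" using nonzero by blast
  have "c l = 0" using insert.prems(1)[OF x(1)] insert.hyps x(2) zero by simp
  then show ?case using insert.prems zero by auto
qed simp

text \<open>Besides making evaluation compatible with \<open>qconj\<close>, these conditions define
  a semigroup under pointwise multiplication.\<close>

definition hermitian_params :: "(num \<Rightarrow> num \<Rightarrow> complex) set" where
  "hermitian_params = {q. \<forall>i j. cnj (q i j) = q j i \<and> cmod (q i j) < 1}"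

text \<open>Only the two indeterminates at a place where the exponents differ are varied: the
  modulus of the value sees the sum of their exponents, its phase the difference.\<close>

lemma monomials_separated:
  assumes "m \<noteq> n"
  shows "\<exists>q\<in>hermitian_params. monom_at q m \<noteq> monom_at q n"
proof (rule ccontr)
  assume "\<not> ?thesis"
  then have eq: "monom_at q m = monom_at q n" if "q \<in> hermitian_params" for q
    using that by blast
  obtain i j where ij: "Poly_Mapping.lookup m (i, j) \<noteq> Poly_Mapping.lookup n (i, j)"
    using assms by (metis poly_mapping_eqI surj_pair)
  define r where "r z = (\<lambda>a b. if (a, b) = (i, j) then z else if (a, b) = (j, i) then cnj z else 1)"
    for z :: complex
  \<comment> \<open>The phase argument needs values of modulus 1, outside the open disc. Multiplying
    by the constant point 1/2 brings them inside; its contribution is nonzero and equal for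
    \<open>m\<close> and \<open>n\<close>. On the diagonal a Hermitian entry must be real.\<close>
  have r_eq: "monom_at (r z) m = monom_at (r z) n"
    if "cmod z \<le> 1" "i \<noteq> j \<or> cnj z = z" for z
  proof -
    let ?h = "(\<lambda>_ _. 1 / 2) :: num \<Rightarrow> num \<Rightarrow> complex"
    have h: "?h \<in> hermitian_params" by (simp add: hermitian_params_def)
    have "cnj (r z a b) = r z b a" for a b
      unfolding r_def using that(2)
      by (cases "a = i"; cases "b = j"; cases "a = j"; cases "b = i") simp_all
    moreover have r_le: "cmod (r z a b) \<le> 1" for a b
      using that(1) by (simp add: r_def)
    moreover from r_le have "cmod (r z a b) < 2" for a b
      by (rule le_less_trans) simp
    ultimately have "(\<lambda>a b. ?h a b * r z a b) \<in> hermitian_params"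
      by (simp add: hermitian_params_def norm_divide)
    from eq[OF this, unfolded monom_at_mult] eq[OF h] monom_at_nonzero[of ?h n] show ?thesis
      by simp
  qed
  have r_at: "monom_at (r z) k = (\<Prod>ab\<in>{(i, j), (j, i)}. r z (fst ab) (snd ab) ^ Poly_Mapping.lookup k ab)"
    for z k
  proof -
    have "monom_at (r z) k = (\<Prod>ab\<in>Poly_Mapping.keys k \<union> {(i, j), (j, i)}.
        r z (fst ab) (snd ab) ^ Poly_Mapping.lookup k ab)"
      by (rule monom_at_superset) auto
    also have "\<dots> = (\<Prod>ab\<in>{(i, j), (j, i)}. r z (fst ab) (snd ab) ^ Poly_Mapping.lookup k ab)"
      by (rule prod.mono_neutral_right) (auto simp: r_def)
    finally show ?thesis .
  qed
  show False
  proof (cases "i = j")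
    case True
    then have "(1 / 2 :: complex) ^ Poly_Mapping.lookup m (i, j) = (1 / 2) ^ Poly_Mapping.lookup n (i, j)"
      using r_eq[of "1 / 2"] by (simp add: r_at) (simp add: r_def)
    then have "(1 / 2 :: real) ^ Poly_Mapping.lookup m (i, j) = (1 / 2) ^ Poly_Mapping.lookup n (i, j)"
      by (auto dest!: arg_cong[where f = cmod] simp: norm_power norm_divide)
    then show False using ij by (simp add: power_inject_exp')
  next
    case False
    define a b a' b' where "a = Poly_Mapping.lookup m (i, j)" "b = Poly_Mapping.lookup m (j, i)"
      "a' = Poly_Mapping.lookup n (i, j)" "b' = Poly_Mapping.lookup n (j, i)"
    note defs = this
    have z: "z ^ a * cnj z ^ b = z ^ a' * cnj z ^ b'" if "cmod z \<le> 1" for z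
      using r_eq[of z] that False by (simp add: r_at) (simp add: r_def defs)
    have "(1 / 2 :: complex) ^ (a + b) = (1 / 2) ^ (a' + b')"
      using z[of "1 / 2"] by (simp add: power_add)
    then have "(1 / 2 :: real) ^ (a + b) = (1 / 2) ^ (a' + b')"
      by (auto dest!: arg_cong[where f = cmod] simp: norm_power norm_divide)
    then have deg: "a + b = a' + b'" by (simp add: power_inject_exp')
    \<comment> \<open>Small enough that \<open>2 * a * \<theta>\<close> and
      \<open>2 * a' * \<theta>\<close> both lie between 0 and \<open>pi\<close>, where the cosine is
      injective.\<close>
    define \<theta> where "\<theta> = pi / (2 * (a + a' + 1))"
    have u: "cis \<theta> ^ k * cnj (cis \<theta>) ^ l * cis \<theta> ^ (k + l) = cis (2 * real k * \<theta>)" for k l :: nat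
    proof -
      have "cnj (cis \<theta>) ^ l * cis \<theta> ^ l = 1"
        by (simp add: cis_cnj cis_mult flip: power_mult_distrib)
      then have "cis \<theta> ^ k * cnj (cis \<theta>) ^ l * cis \<theta> ^ (k + l) = cis \<theta> ^ (k + k)"
        by (simp add: power_add)
      then show ?thesis by (simp add: Complex.DeMoivre)
    qed
    have "cis (2 * real a * \<theta>) = cis (2 * real a' * \<theta>)"
      using z[of "cis \<theta>"] u[of a b] u[of a' b'] deg by simp
    then have cos: "cos (2 * real a * \<theta>) = cos (2 * real a' * \<theta>)" by (simp add: cis.ctr)
    have le: "2 * real k * \<theta> \<le> pi" if "k \<le> a + a'" for k :: nat
      using that mult_left_mono[of "real k" "real (a + a' + 1)" "2 * pi"]
      by (simp add: \<theta>_def field_simps)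
    have pos: "0 < \<theta>" by (simp add: \<theta>_def)
    then have ge: "0 \<le> 2 * real k * \<theta>" for k :: nat by simp
    have "2 * real a * \<theta> = 2 * real a' * \<theta>"
      by (rule cos_inj_pi[OF ge le ge le cos]) simp_all
    then have "a = a'" using pos by simp
    then show False using ij by (simp add: defs)
  qed
qed

lemma poly_zero_if_vanishes:
  assumes "\<And>q. q \<in> hermitian_params \<Longrightarrow> poly_at q p = 0"
  shows "p = 0"
proof (rule poly_mapping_eqI, simp, rule ccontr)
  fix m assume m: "Poly_Mapping.lookup p m \<noteq> 0"
  have "Poly_Mapping.lookup p m = 0"
  proof (rule characters_independent[where S = hermitian_params and \<chi> = "\<lambda>m q. monom_at q m"
        and f = "\<lambda>q r i j. q i j * r i j" and K = "Poly_Mapping.keys p"])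
    fix q r assume "q \<in> hermitian_params" "r \<in> hermitian_params"
    then show "(\<lambda>i j. q i j * r i j) \<in> hermitian_params"
      using mult_strict_mono'[of "cmod (q i j)" 1 "cmod (r i j)" 1 for i j]
      by (simp add: hermitian_params_def norm_mult)
  next
    fix k
    show "\<exists>q\<in>hermitian_params. monom_at q k \<noteq> 0"
      by (rule bexI[of _ "\<lambda>_ _. 1 / 2"]) (simp_all add: monom_at_nonzero hermitian_params_def)
  next
    fix q assume "q \<in> hermitian_params"
    then show "(\<Sum>m\<in>Poly_Mapping.keys p. Poly_Mapping.lookup p m * monom_at q m) = 0"
      using assms[of q] by (simp add: poly_at_superset[of "Poly_Mapping.keys p"])
  qed (use m in \<open>auto simp: monom_at_mult monomials_separated in_keys_iff\<close>)
  then show False using m by simp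
qed

section \<open>Braided permutations\<close>

text \<open>
  Words are extended to infinite sequences of letters, so that every adjacent transposition acts
  and the braid relations carry no side conditions on lengths.
\<close>

definition braid :: "(num \<Rightarrow> num \<Rightarrow> complex) \<Rightarrow> nat \<Rightarrow> ((nat \<Rightarrow> num) \<Rightarrow> complex) \<Rightarrow> (nat \<Rightarrow> num) \<Rightarrow> complex"
  where "braid q i x = (\<lambda>f. q (f i) (f (Suc i)) * x (f(i := f (Suc i), Suc i := f i)))"

lemma braid_far:
  assumes "Suc i < j"
  shows "braid q i (braid q j x) = braid q j (braid q i x)"
  using assms by (auto simp: braid_def fun_upd_twist fun_eq_iff)

lemma braid_relation:
  "braid q i (braid q (Suc i) (braid q i x)) = braid q (Suc i) (braid q i (braid q (Suc i) x))"
  by (auto simp: braid_def fun_eq_iff fun_upd_twist intro!: arg_cong[where f = x])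

text \<open>The lift of a cyclic permutation to a product of adjacent braidings;
  \<open>cycle_eq\<close> gives its closed form.\<close>

primrec cycle :: "(num \<Rightarrow> num \<Rightarrow> complex) \<Rightarrow> nat \<Rightarrow> ((nat \<Rightarrow> num) \<Rightarrow> complex) \<Rightarrow> (nat \<Rightarrow> num) \<Rightarrow> complex"
where
  "cycle q 0 x = x"
| "cycle q (Suc k) x = braid q k (cycle q k x)"

lemma cycle_braid_far: "k < j \<Longrightarrow> cycle q k (braid q j x) = braid q j (cycle q k x)"
  by (induction k) (simp_all add: braid_far[symmetric])

text \<open>Moving a braiding through the cycle lowers its index. The factors of index below
  \<open>i\<close> and above \<open>i + 1\<close> commute with what has to pass them, and the braid
  relation handles the two in the middle.\<close>

lemma cycle_braid: "Suc i < k \<Longrightarrow> cycle q k (braid q (Suc i) x) = braid q i (cycle q k x)"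
proof (induction k)
  case (Suc k)
  show ?case
  proof (cases "Suc i = k")
    case True
    have "cycle q (Suc k) (braid q (Suc i) x)
        = braid q (Suc i) (braid q i (braid q (Suc i) (cycle q i x)))"
      by (simp add: cycle_braid_far flip: True)
    then show ?thesis by (simp add: braid_relation flip: True)
  next
    case False
    then have "Suc i < k" using Suc.prems by simp
    then show ?thesis by (simp add: Suc.IH braid_far[of i k])
  qed
qed simp

text \<open>Each factor of the inner cycle except \<open>braid q 0\<close> passes the outer one with
  its index lowered; the lowest one stays where it is.\<close>

lemma cycle_cycle: "m < k \<Longrightarrow> cycle q k (cycle q (Suc m) x) = cycle q m (cycle q k (braid q 0 x))"
proof (induction m)
  case (Suc m)
  have "cycle q k (cycle q (Suc (Suc m)) x) = braid q m (cycle q k (cycle q (Suc m) x))"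
    by (subst cycle.simps(2), rule cycle_braid) (use Suc.prems in simp)
  then show ?case using Suc by simp
qed simp

lemma cycle_add: "cycle q k (\<lambda>f. x f + y f) = (\<lambda>f. cycle q k x f + cycle q k y f)"
  by (induction k) (simp_all add: braid_def distrib_left)

lemma cycle_diff: "cycle q k (\<lambda>f. x f - y f) = (\<lambda>f. cycle q k x f - cycle q k y f)"
  by (induction k) (simp_all add: braid_def right_diff_distrib)

lemma cycle_of_sum: "cycle q k (\<lambda>f. \<Sum>m<(n::nat). x m f) = (\<lambda>f. \<Sum>m<n. cycle q k (x m) f)"
proof (induction n)
  case 0
  show ?case by (induction k) (simp_all add: braid_def)
qed (simp add: cycle_add)

definition cycle_sum :: "(num \<Rightarrow> num \<Rightarrow> complex) \<Rightarrow> nat \<Rightarrow> ((nat \<Rightarrow> num) \<Rightarrow> complex) \<Rightarrow> (nat \<Rightarrow> num) \<Rightarrow> complex"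
where
  "cycle_sum q k x = (\<lambda>f. \<Sum>m<k. cycle q m x f)"

text \<open>
  Zagier's identity \<open>(1 - t\<^sub>k) (t\<^sub>0 + \<dots> + t\<^sub>k) = (t\<^sub>0 + \<dots> + t\<^sub>k\<^sub>-\<^sub>1) (1 - t\<^sub>k s\<^sub>0)\<close> for \<open>t\<^sub>m = s\<^sub>m\<^sub>-\<^sub>1 \<cdots> s\<^sub>0\<close>.
\<close>

lemma cycle_sum_factorisation:
  "cycle_sum q (Suc k) x f - cycle q k (cycle_sum q (Suc k) x) f
    = cycle_sum q k (\<lambda>f. x f - cycle q k (braid q 0 x) f) f"
proof -
  have "cycle q k (cycle_sum q (Suc k) x) f = cycle q k x f + (\<Sum>m<k. cycle q k (cycle q (Suc m) x) f)"
    unfolding cycle_sum_def cycle_of_sum by (subst sum.lessThan_Suc_shift) simp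
  also have "\<dots> = cycle q k x f + (\<Sum>m<k. cycle q m (cycle q k (braid q 0 x)) f)"
    by (simp add: cycle_cycle del: cycle.simps(2))
  finally show ?thesis
    by (simp add: cycle_sum_def cycle_diff sum_subtractf)
qed

section \<open>Norm estimates on sequences over a fixed alphabet\<close>

lemma braid_bound:
  assumes "\<And>f. range f \<subseteq> S \<Longrightarrow> cmod (x f) \<le> B"
    and "\<And>i j. i \<in> S \<Longrightarrow> j \<in> S \<Longrightarrow> cmod (q i j) \<le> r" "range f \<subseteq> S"
  shows "cmod (braid q i x f) \<le> r * B"
proof -
  have "range (f(i := f (Suc i), Suc i := f i)) \<subseteq> S"
    using assms(3) by (auto simp: fun_upd_def)
  moreover have "0 \<le> r" using assms(2)[of "f 0" "f 0"] assms(3) by (auto intro: order_trans[OF norm_ge_zero])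
  ultimately show ?thesis
    unfolding braid_def norm_mult using assms by (intro mult_mono) auto
qed

lemma cycle_bound:
  assumes "\<And>f. range f \<subseteq> S \<Longrightarrow> cmod (x f) \<le> B"
    and "\<And>i j. i \<in> S \<Longrightarrow> j \<in> S \<Longrightarrow> cmod (q i j) \<le> 1" "range f \<subseteq> S"
  shows "cmod (cycle q k x f) \<le> B"
  using assms(3)
proof (induction k arbitrary: f)
  case (Suc k)
  show ?case
    using braid_bound[of S "cycle q k x" B q 1 f k] Suc assms(2) by simp
qed (simp add: assms)

text \<open>In sup norm a cycle does not expand and the extra braiding contracts by
  \<open>r\<close>. So the right factor in \<open>cycle_sum_factorisation\<close> is inverted at
  cost \<open>1 / (1 - r)\<close>, and the left factor at most doubles the bound. Restricting to
  letters in \<open>S\<close> makes a uniform \<open>r < 1\<close> possible.\<close>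

lemma cycle_sum_lower_bound:
  assumes r: "r < 1" "\<And>i j. i \<in> S \<Longrightarrow> j \<in> S \<Longrightarrow> cmod (q i j) \<le> r"
    and bounded: "\<exists>K. \<forall>f. range f \<subseteq> S \<longrightarrow> cmod (x f) \<le> K"
    and B: "\<And>f. range f \<subseteq> S \<Longrightarrow> cmod (cycle_sum q (Suc k) x f) \<le> B"
    and f: "range f \<subseteq> S"
  shows "cmod (x f) \<le> (2 / (1 - r)) ^ k * B"
  using bounded B f
proof (induction k arbitrary: x B f)
  case 0
  then show ?case by (simp add: cycle_sum_def)
next
  case (Suc k)
  have q1: "cmod (q i j) \<le> 1" if "i \<in> S" "j \<in> S" for i j
    using r(1) r(2)[OF that] by simp
  define y where "y = cycle q (Suc k) (braid q 0 x)"
  obtain K where K: "\<And>f. range f \<subseteq> S \<Longrightarrow> cmod (x f) \<le> K" using Suc.prems(1) by blast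
  have y_bound: "cmod (y f) \<le> r * K" if "\<And>f. range f \<subseteq> S \<Longrightarrow> cmod (x f) \<le> K" "range f \<subseteq> S" for K f
    unfolding y_def by (rule cycle_bound[OF braid_bound q1]) (use that r in auto)
  have "cmod (x f - y f) \<le> (2 / (1 - r)) ^ k * (2 * B)" if "range f \<subseteq> S" for f
  proof (rule Suc.IH[OF _ _ that])
    have "cmod (x f - y f) \<le> K + r * K" if "range f \<subseteq> S" for f
      using K[OF that] y_bound[OF K that] norm_triangle_ineq4[of "x f" "y f"] by simp
    then show "\<exists>K. \<forall>f. range f \<subseteq> S \<longrightarrow> cmod (x f - y f) \<le> K" by blast
  next
    fix f :: "nat \<Rightarrow> num" assume f: "range f \<subseteq> S"
    have "cmod (cycle q (Suc k) (cycle_sum q (Suc (Suc k)) x) f) \<le> B"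
      by (rule cycle_bound[OF Suc.prems(2) q1 f])
    then show "cmod (cycle_sum q (Suc k) (\<lambda>f. x f - y f) f) \<le> 2 * B"
      using Suc.prems(2)[OF f] cycle_sum_factorisation[of q "Suc k" x f]
        norm_triangle_ineq4[of "cycle_sum q (Suc (Suc k)) x f"
          "cycle q (Suc k) (cycle_sum q (Suc (Suc k)) x) f"]
      by (simp add: y_def del: cycle.simps)
  qed
  note diff = this
  \<comment> \<open>Finite by the boundedness hypothesis, so that \<open>r * M\<close> can be
    absorbed into the left side below.\<close>
  define M where "M = (SUP f\<in>{f. range f \<subseteq> S}. cmod (x f))"
  have bdd: "bdd_above ((\<lambda>f. cmod (x f)) ` {f. range f \<subseteq> S})"
    using K by (auto intro!: bdd_aboveI[where M = K])
  have M: "cmod (x f) \<le> M" if "range f \<subseteq> S" for f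
    unfolding M_def by (rule cSUP_upper[OF _ bdd]) (use that in simp)
  have "M \<le> (2 / (1 - r)) ^ k * (2 * B) + r * M"
  proof (subst (1) M_def, rule cSUP_least)
    show "{f. range f \<subseteq> S} \<noteq> {}" using Suc.prems(3) by blast
    fix f :: "nat \<Rightarrow> num" assume "f \<in> {f. range f \<subseteq> S}"
    then have f: "range f \<subseteq> S" by simp
    show "cmod (x f) \<le> (2 / (1 - r)) ^ k * (2 * B) + r * M"
      using diff[OF f] y_bound[OF M f] norm_triangle_ineq[of "x f - y f" "y f"] by simp
  qed
  then have "M \<le> (2 / (1 - r)) ^ Suc k * B"
    using r(1) by (simp add: field_simps)
  then show ?case using M[OF Suc.prems(3)] by simp
qed

text \<open>The letter at position \<open>m\<close> is pulled to the front past the letters before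
  it, with the weight found in the recursion of \<open>gram\<close>.\<close>

lemma cycle_eq:
  "cycle q m x f = (\<Prod>l<m. q (f l) (f m)) *
     x (\<lambda>l. if l = 0 then f m else if l \<le> m then f (l - 1) else f l)"
proof (induction m arbitrary: f)
  case 0
  show ?case by (auto intro!: arg_cong[where f = x])
next
  case (Suc m)
  have "(\<Prod>l<m. q ((f(m := f (Suc m), Suc m := f m)) l) ((f(m := f (Suc m), Suc m := f m)) m))
      = (\<Prod>l<m. q (f l) (f (Suc m)))"
    by (rule prod.cong) auto
  moreover have "(\<lambda>l. if l = 0 then (f(m := f (Suc m), Suc m := f m)) m else
        if l \<le> m then (f(m := f (Suc m), Suc m := f m)) (l - 1) else (f(m := f (Suc m), Suc m := f m)) l)
      = (\<lambda>l. if l = 0 then f (Suc m) else if l \<le> Suc m then f (l - 1) else f l)"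
    by (auto simp: fun_eq_iff)
  ultimately show ?case
    by (simp add: braid_def Suc.IH mult.assoc mult.commute)
qed

section \<open>The Gram matrix\<close>

abbreviation del_nth :: "nat \<Rightarrow> 'a list \<Rightarrow> 'a list" where
  "del_nth m w \<equiv> take m w @ drop (Suc m) w"

text \<open>
  The pairing of \<open>|v\<rangle>\<close> with \<open>|w\<rangle>\<close>: the adjoint of the first creation operator of \<open>v\<close>
  is moved through \<open>w\<close>, picking up a factor for every letter it passes.
\<close>

fun gram :: "(num \<Rightarrow> num \<Rightarrow> 'r::comm_semiring_1) \<Rightarrow> num list \<Rightarrow> num list \<Rightarrow> 'r" where
  "gram q [] w = (if w = [] then 1 else 0)"
| "gram q (j # v) w = (\<Sum>m<length w.
     if w ! m = j then (\<Prod>l<m. q (w ! l) j) * gram q v (del_nth m w) else 0)"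

lemma gram_length: "length v \<noteq> length w \<Longrightarrow> gram q v w = 0"
proof (induction v arbitrary: w)
  case (Cons j v)
  have "gram q v (del_nth m w) = 0" if "m < length w" for m
    by (rule Cons.IH) (use that Cons.prems in auto)
  then show ?case by (simp add: sum.neutral)
qed simp

text \<open>Every letter passed contributes a factor 0, so only the term that passes none survives.
  This is the starting point of the deformation.\<close>

lemma gram_zero: "gram (\<lambda>_ _. 0 :: 'r::comm_semiring_1) v w = (if v = w then 1 else 0)"
proof (induction v arbitrary: w)
  case (Cons j v)
  show ?case
  proof (cases w)
    case w: (Cons i w')
    show ?thesis
      by (simp add: w Cons.IH sum.lessThan_Suc_shift prod.lessThan_Suc_shift cong: if_cong del: prod.lessThan_Suc sum.lessThan_Suc prod_constant)
  qed simp
qed simp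

abbreviation words :: "num set \<Rightarrow> nat \<Rightarrow> num list set" where
  "words S n \<equiv> {w. set w \<subseteq> S \<and> length w = n}"

lemma sum_words_Suc:
  assumes "finite S"
  shows "(\<Sum>v\<in>words S (Suc n). g v) = (\<Sum>j\<in>S. \<Sum>v\<in>words S n. g (j # v))"
proof -
  have "words S (Suc n) = (\<lambda>(j, v). j # v) ` (S \<times> words S n)"
    by (auto simp: length_Suc_conv image_iff)
  moreover have "inj_on (\<lambda>(j, v). j # v) (S \<times> words S n)"
    by (auto simp: inj_on_def)
  ultimately show ?thesis
    by (simp add: sum.reindex sum.cartesian_product comp_def case_prod_beta')
qed

text \<open>The Gram operator on words of length \<open>n + 1\<close> is \<open>cycle_sum q (n + 1)\<close> after \<open>1 \<otimes> G\<^sub>n\<close>.\<close>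

lemma gram_lower_bound:
  assumes "finite S" "r < 1" "\<And>i j. i \<in> S \<Longrightarrow> j \<in> S \<Longrightarrow> cmod (q i j) \<le> r"
  shows "\<exists>C\<ge>0. \<forall>x B. (\<forall>w\<in>words S n. cmod (\<Sum>v\<in>words S n. x v * gram q v w) \<le> B) \<longrightarrow>
    (\<forall>w\<in>words S n. cmod (x w) \<le> C * B)"
proof (induction n)
  case 0
  have "words S 0 = {[]}" by auto
  then show ?case by (intro exI[of _ 1]) auto
next
  case (Suc n)
  then obtain C where C: "0 \<le> C" "\<And>x B w. (\<And>w. w \<in> words S n \<Longrightarrow>
      cmod (\<Sum>v\<in>words S n. x v * gram q v w) \<le> B) \<Longrightarrow> w \<in> words S n \<Longrightarrow> cmod (x w) \<le> C * B"
    by blast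
  define D where "D = (2 / (1 - r)) ^ n"
  have fin: "finite (words S k)" for k
    by (rule finite_lists_length_eq[OF \<open>finite S\<close>])
  have "cmod (x w) \<le> C * D * B"
    if B: "\<And>w. w \<in> words S (Suc n) \<Longrightarrow> cmod (\<Sum>v\<in>words S (Suc n). x v * gram q v w) \<le> B"
      and w: "w \<in> words S (Suc n)" for x B w
  proof -
    \<comment> \<open>\<open>y\<close> is \<open>x\<close> after the Gram operator on all letters
      but the first; \<open>Y\<close> reads it off the first \<open>n + 1\<close> letters of a
      sequence.\<close>
    define y where "y w = (\<Sum>v\<in>words S n. x (hd w # v) * gram q v (tl w))" for w
    define Y where "Y f = y (map f [0..<Suc n])" for f :: "nat \<Rightarrow> num"
    have mapf: "map f [0..<Suc n] \<in> words S (Suc n)" if "range f \<subseteq> S" for f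
      using that by auto
    have Y_sum: "cycle_sum q (Suc n) Y f
        = (\<Sum>v\<in>words S (Suc n). x v * gram q v (map f [0..<Suc n]))" if "range f \<subseteq> S" for f
    proof -
      let ?u = "map f [0..<Suc n]"
      have "cycle q m Y f = (\<Prod>l<m. q (?u ! l) (?u ! m)) *
          (\<Sum>v\<in>words S n. x (?u ! m # v) * gram q v (del_nth m ?u))" if "m < Suc n" for m
      proof -
        have "map (\<lambda>l. if l = 0 then f m else if l \<le> m then f (l - 1) else f l) [0..<Suc n]
            = f m # del_nth m ?u"
        proof (rule nth_equalityI)
          show "length (map (\<lambda>l. if l = 0 then f m else if l \<le> m then f (l - 1) else f l) [0..<Suc n])
            = length (f m # del_nth m ?u)" using that by simp
          fix l assume "l < length (map (\<lambda>l. if l = 0 then f m else if l \<le> m then f (l - 1) else f l) [0..<Suc n])"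
          then show "map (\<lambda>l. if l = 0 then f m else if l \<le> m then f (l - 1) else f l) [0..<Suc n] ! l
              = (f m # del_nth m ?u) ! l"
            using that by (cases l) (auto simp: nth_append nth_Cons' simp del: upt_Suc)
        qed
        moreover have "(\<Prod>l<m. q (f l) (f m)) = (\<Prod>l<m. q (?u ! l) (?u ! m))"
          by (rule prod.cong) (use that in \<open>auto simp del: upt_Suc\<close>)
        moreover have "?u ! m = f m" using that by (simp del: upt_Suc)
        ultimately show ?thesis by (simp add: cycle_eq Y_def y_def del: upt_Suc)
      qed
      then have "cycle_sum q (Suc n) Y f = (\<Sum>m<Suc n. (\<Prod>l<m. q (?u ! l) (?u ! m)) *
          (\<Sum>v\<in>words S n. x (?u ! m # v) * gram q v (del_nth m ?u)))"
        by (simp add: cycle_sum_def del: sum.lessThan_Suc upt_Suc)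
      \<comment> \<open>Exactly one letter of \<open>S\<close> equals \<open>?u ! m\<close>. The sum
        over \<open>j\<close> is introduced to supply the first letters of the longer words.\<close>
      also have "\<dots> = (\<Sum>m<Suc n. \<Sum>j\<in>S. if ?u ! m = j then (\<Prod>l<m. q (?u ! l) j) *
          (\<Sum>v\<in>words S n. x (j # v) * gram q v (del_nth m ?u)) else 0)"
      proof (rule sum.cong[OF refl])
        fix m assume "m \<in> {..<Suc n}"
        then have "?u ! m \<in> S" using \<open>range f \<subseteq> S\<close> by (auto simp del: upt_Suc)
        then show "(\<Prod>l<m. q (?u ! l) (?u ! m)) *
            (\<Sum>v\<in>words S n. x (?u ! m # v) * gram q v (del_nth m ?u))
          = (\<Sum>j\<in>S. if ?u ! m = j then (\<Prod>l<m. q (?u ! l) j) *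
            (\<Sum>v\<in>words S n. x (j # v) * gram q v (del_nth m ?u)) else 0)"
          using \<open>finite S\<close> by (simp del: upt_Suc)
      qed
      also have "\<dots> = (\<Sum>j\<in>S. \<Sum>m<Suc n. \<Sum>v\<in>words S n. x (j # v) *
          (if ?u ! m = j then (\<Prod>l<m. q (?u ! l) j) * gram q v (del_nth m ?u) else 0))"
        by (subst sum.swap, intro sum.cong refl)
          (simp add: sum_distrib_left mult.left_commute del: upt_Suc)
      also have "\<dots> = (\<Sum>j\<in>S. \<Sum>v\<in>words S n. x (j # v) * gram q (j # v) ?u)"
        by (intro sum.cong refl, subst sum.swap) (simp add: sum_distrib_left del: upt_Suc sum.lessThan_Suc)
      also have "\<dots> = (\<Sum>v\<in>words S (Suc n). x v * gram q v ?u)"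
        by (rule sum_words_Suc[OF \<open>finite S\<close>, symmetric])
      finally show ?thesis .
    qed
    have "cmod (y w) \<le> D * B" if "w \<in> words S (Suc n)" for w
    proof -
      \<comment> \<open>Padding with the first letter of \<open>w\<close>, which exists since the
        length is \<open>n + 1\<close>, keeps the range inside \<open>S\<close>.\<close>
      define f where "f l = (if l < length w then w ! l else w ! 0)" for l
      have f: "range f \<subseteq> S" using that by (force simp: f_def)
      have wf: "map f [0..<Suc n] = w"
        by (rule nth_equalityI) (use that in \<open>auto simp: f_def simp del: upt_Suc\<close>)
      have "cmod (Y f) \<le> D * B"
        unfolding D_def
      proof (rule cycle_sum_lower_bound[OF assms(2,3) _ _ f])
        show "\<exists>K. \<forall>f. range f \<subseteq> S \<longrightarrow> cmod (Y f) \<le> K"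
          using mapf fin unfolding Y_def
          by (intro exI[of _ "Max ((\<lambda>w. cmod (y w)) ` words S (Suc n))"] allI impI Max_ge) auto
        show "cmod (cycle_sum q (Suc n) Y f) \<le> B" if "range f \<subseteq> S" for f
          using B[OF mapf[OF that]] Y_sum[OF that] by simp
      qed
      then show ?thesis unfolding Y_def wf .
    qed
    note y_bound = this
    obtain j v where jv: "w = j # v" "j \<in> S" "v \<in> words S n"
      using w by (auto simp: length_Suc_conv)
    have "cmod (x (j # v)) \<le> C * (D * B)"
    proof (rule C(2)[OF _ jv(3)])
      fix w' assume "w' \<in> words S n"
      then show "cmod (\<Sum>v\<in>words S n. x (j # v) * gram q v w') \<le> D * B"
        using y_bound[of "j # w'"] jv by (simp add: y_def)
    qed
    then show ?thesis using jv by (simp add: mult.assoc)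
  qed
  moreover have "0 \<le> C * D" using C \<open>r < 1\<close> by (simp add: D_def)
  ultimately show ?case by blast
qed

text \<open>The recursion uses semiring operations only, so it commutes with
  \<open>poly_at q\<close>, which turns the polynomial Gram matrix into the complex one.\<close>

lemma gram_hom:
  assumes "h 0 = 0" "h 1 = 1" "\<And>a b. h (a + b) = h a + h b" "\<And>a b. h (a * b) = h a * h b"
  shows "h (gram q v w) = gram (\<lambda>i j. h (q i j)) v w"
proof (induction v arbitrary: w)
  case (Cons j v)
  have sum: "h (\<Sum>k\<in>K. f k) = (\<Sum>k\<in>K. h (f k))" for K :: "nat set" and f
    by (induction K rule: infinite_finite_induct) (simp_all add: assms)
  have prod: "h (\<Prod>k\<in>K. f k) = (\<Prod>k\<in>K. h (f k))" for K :: "nat set" and f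
    by (induction K rule: infinite_finite_induct) (simp_all add: assms)
  show ?case by (simp add: sum prod assms Cons.IH if_distrib[of h] cong: if_cong)
qed (simp add: assms)

lemma continuous_on_gram:
  fixes q :: "num \<Rightarrow> num \<Rightarrow> complex"
  shows "continuous_on A (\<lambda>t :: real. gram (\<lambda>i j. t * q i j) v w)"
proof (induction v arbitrary: w)
  case (Cons j v)
  show ?case
    unfolding gram.simps
  proof (rule continuous_on_sum)
    fix m
    show "continuous_on A (\<lambda>t. if w ! m = j
        then (\<Prod>l<m. t * q (w ! l) j) * gram (\<lambda>i j. t * q i j) v (del_nth m w) else 0)"
      by (cases "w ! m = j") (auto intro!: continuous_intros Cons.IH)
  qed
qed simp

text \<open>Words of different lengths are orthogonal, so the matrix splits into blocks; the sum of
  the block constants dominates each of them.\<close>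

lemma gram_lower_bound_upto:
  fixes n :: nat
  assumes "finite S" "r < 1" "\<And>i j. i \<in> S \<Longrightarrow> j \<in> S \<Longrightarrow> cmod (q i j) \<le> r"
  defines "W \<equiv> {w :: num list. set w \<subseteq> S \<and> length w \<le> n}"
  shows "\<exists>C\<ge>0. \<forall>x B. (\<forall>w\<in>W. cmod (\<Sum>v\<in>W. x v * gram q v w) \<le> B) \<longrightarrow>
    (\<forall>w\<in>W. cmod (x w) \<le> C * B)"
proof -
  have W: "finite W"
    unfolding W_def by (rule finite_lists_length_le[OF \<open>finite S\<close>])
  define bound where "bound k C \<longleftrightarrow> 0 \<le> C \<and> (\<forall>x B. (\<forall>w\<in>words S k. cmod (\<Sum>v\<in>words S k. x v * gram q v w) \<le> B) \<longrightarrow>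
    (\<forall>w\<in>words S k. cmod (x w) \<le> C * B))" for k C
  have "\<exists>C. bound k C" for k
    using gram_lower_bound[OF assms(1,2), of q k] assms(3) unfolding bound_def by blast
  then obtain C where bound: "\<And>k. bound k (C k)" by metis
  have C: "\<And>k. 0 \<le> C k"
    "\<And>k x B w. \<lbrakk>\<And>w. w \<in> words S k \<Longrightarrow> cmod (\<Sum>v\<in>words S k. x v * gram q v w) \<le> B;
      w \<in> words S k\<rbrakk> \<Longrightarrow> cmod (x w) \<le> C k * B"
    using bound unfolding bound_def by blast+
  have "cmod (x w) \<le> (\<Sum>k\<le>n. C k) * B"
    if B: "\<And>w. w \<in> W \<Longrightarrow> cmod (\<Sum>v\<in>W. x v * gram q v w) \<le> B" and w: "w \<in> W" for x B w
  proof -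
    have sum_eq: "(\<Sum>v\<in>W. x v * gram q v u) = (\<Sum>v\<in>words S (length w). x v * gram q v u)"
      if "u \<in> words S (length w)" for u
      by (rule sum.mono_neutral_right[OF W]) (use that w in \<open>auto simp: W_def gram_length\<close>)
    have "cmod (x w) \<le> C (length w) * B"
    proof (rule C(2))
      fix u assume u: "u \<in> words S (length w)"
      then have "u \<in> W" using w by (auto simp: W_def)
      then show "cmod (\<Sum>v\<in>words S (length w). x v * gram q v u) \<le> B"
        using B sum_eq[OF u] by metis
    qed (use w in \<open>auto simp: W_def\<close>)
    also have "0 \<le> B" using B[OF w] norm_ge_zero order_trans by blast
    then have "C (length w) * B \<le> (\<Sum>k\<le>n. C k) * B"
      by (intro mult_right_mono member_le_sum) (use w C in \<open>auto simp: W_def\<close>)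
    finally show ?thesis .
  qed
  moreover have "0 \<le> (\<Sum>k\<le>n. C k)" by (intro sum_nonneg C)
  ultimately show ?thesis by blast
qed

section \<open>Deformation of Hermitian forms\<close>

lemma continuous_on_real_near:
  fixes f :: "real \<Rightarrow> 'b::real_normed_vector"
  assumes "continuous_on A f" "t \<in> A" "0 < e"
  shows "\<exists>d>0. \<forall>s\<in>A. \<bar>s - t\<bar> < d \<longrightarrow> norm (f s - f t) < e"
proof -
  have "(f \<longlongrightarrow> f t) (at t within A)" using assms by (simp add: continuous_on_def)
  from tendstoD[OF this \<open>0 < e\<close>] obtain d where d: "0 < d"
    "\<And>s. s \<in> A \<Longrightarrow> s \<noteq> t \<Longrightarrow> \<bar>s - t\<bar> < d \<Longrightarrow> norm (f s - f t) < e"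
    by (auto simp: eventually_at dist_norm)
  have "norm (f s - f t) < e" if "s \<in> A" "\<bar>s - t\<bar> < d" for s
    using d(2)[OF that(1) _ that(2)] \<open>0 < e\<close> by (cases "s = t") auto
  then show ?thesis using d(1) by blast
qed

definition sesq :: "'a set \<Rightarrow> ('a \<Rightarrow> 'a \<Rightarrow> complex) \<Rightarrow> ('a \<Rightarrow> complex) \<Rightarrow> ('a \<Rightarrow> complex) \<Rightarrow> complex" where
  "sesq W g x y = (\<Sum>v\<in>W. \<Sum>w\<in>W. x v * cnj (y w) * g v w)"

text \<open>Cauchy-Schwarz against the unit vector at \<open>w\<close>.\<close>

lemma semidefinite_bound:
  assumes "finite W" "w \<in> W" "cmod (g w w) \<le> b" "0 < b"
    and herm: "\<And>v w. v \<in> W \<Longrightarrow> w \<in> W \<Longrightarrow> g w v = cnj (g v w)"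
    and pos: "\<And>x. 0 \<le> Re (sesq W g x x)"
  shows "(cmod (\<Sum>v\<in>W. x v * g v w))\<^sup>2 \<le> b * Re (sesq W g x x)"
proof -
  define a where "a = (\<Sum>v\<in>W. x v * g v w)"
  \<comment> \<open>The minimiser of \<open>2 * Re (cnj c * a) + b * (cmod c)\<^sup>2\<close>, which
    bounds the change of the form along the unit vector at \<open>w\<close>.\<close>
  define c where "c = - a / b"
  define d where "d = (\<lambda>v. if v = w then c else 0)"
  have d_sum: "(\<Sum>v\<in>W. d v * f v) = c * f w" "(\<Sum>v\<in>W. cnj (d v) * f v) = cnj c * f w" for f
    using assms(1,2) by (subst sum.mono_neutral_right[of W "{w}"]; auto simp: d_def)+
  have sesq_eq: "sesq W g y z = (\<Sum>v\<in>W. y v * (\<Sum>w\<in>W. cnj (z w) * g v w))" for y z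
    by (simp add: sesq_def sum_distrib_left mult.assoc)
  have "cnj a = (\<Sum>v\<in>W. cnj (x v) * g w v)"
    using assms(2) by (simp add: a_def herm[of _ w])
  then have dx: "sesq W g d x = c * cnj a" by (simp add: sesq_eq d_sum)
  have xd: "sesq W g x d = cnj c * a"
    by (simp add: sesq_eq d_sum a_def sum_distrib_left mult.left_commute)
  have dd: "sesq W g d d = c * cnj c * g w w" by (simp add: sesq_eq d_sum)
  have "sesq W g (\<lambda>v. x v + d v) (\<lambda>v. x v + d v)
      = sesq W g x x + sesq W g x d + sesq W g d x + sesq W g d d"
    by (simp add: sesq_def algebra_simps sum.distrib)
  then have "0 \<le> Re (sesq W g x x + cnj c * a + c * cnj a + c * cnj c * g w w)"
    using pos[of "\<lambda>v. x v + d v"] by (simp add: xd dx dd)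
  also have "c * cnj c * g w w = (cmod c)\<^sup>2 * g w w"
    by (simp only: complex_norm_square)
  also have "Re (sesq W g x x + cnj c * a + c * cnj a + (cmod c)\<^sup>2 * g w w)
      = Re (sesq W g x x) - 2 * (cmod a)\<^sup>2 / b + (cmod c)\<^sup>2 * Re (g w w)"
    by (simp add: c_def cmod_def power2_eq_square[symmetric])
  also have "(cmod c)\<^sup>2 * Re (g w w) \<le> (cmod a)\<^sup>2 / b"
  proof -
    have "Re (g w w) \<le> b" using complex_Re_le_cmod assms(3) by (rule order_trans)
    then have "(cmod c)\<^sup>2 * Re (g w w) \<le> (cmod c)\<^sup>2 * b" by (intro mult_left_mono) auto
    also have "\<dots> = (cmod a)\<^sup>2 / b"
      using \<open>0 < b\<close> by (simp add: c_def norm_divide power2_eq_square)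
    finally show ?thesis .
  qed
  finally show ?thesis using \<open>0 < b\<close> by (simp add: a_def field_simps)
qed

lemma sesq_diff:
  fixes g :: "'a \<Rightarrow> 'a \<Rightarrow> complex"
  shows "sesq W (\<lambda>v w. g v w - h v w) x y = sesq W g x y - sesq W h x y"
  by (simp add: sesq_def right_diff_distrib sum_subtractf)

lemma sesq_bound:
  assumes "\<And>v w. v \<in> W \<Longrightarrow> w \<in> W \<Longrightarrow> cmod (g v w) \<le> e" "\<And>v. v \<in> W \<Longrightarrow> cmod (x v) \<le> K"
  shows "cmod (sesq W g x x) \<le> real (card W) * (real (card W) * (K * K * e))"
proof -
  have "cmod (\<Sum>v\<in>W. \<Sum>w\<in>W. x v * cnj (x w) * g v w) \<le> (\<Sum>v\<in>W. \<Sum>w\<in>W. K * K * e)"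
  proof (intro sum_norm_le)
    fix v w assume "v \<in> W" "w \<in> W"
    then show "cmod (x v * cnj (x w) * g v w) \<le> K * K * e"
      unfolding norm_mult complex_mod_cnj using assms
      by (intro mult_mono) (auto intro: order_trans[OF norm_ge_zero])
  qed
  then show ?thesis by (simp add: sesq_def)
qed

text \<open>Cauchy-Schwarz bounds the image of \<open>x\<close> under the matrix by the square root
  of the form, and the lower bound turns this into a bound on \<open>x\<close>. Semidefinite and
  nondegenerate thus gives definite, with a constant.\<close>

lemma semidefinite_coercive:
  assumes W: "finite W"
    and herm: "\<And>v w. v \<in> W \<Longrightarrow> w \<in> W \<Longrightarrow> g w v = cnj (g v w)"
    and pos: "\<And>x. 0 \<le> Re (sesq W g x x)"
    and lower: "\<exists>C\<ge>0. \<forall>x B. (\<forall>w\<in>W. cmod (\<Sum>v\<in>W. x v * g v w) \<le> B) \<longrightarrow> (\<forall>w\<in>W. cmod (x w) \<le> C * B)"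
  shows "\<exists>K>0. \<forall>x. \<forall>w\<in>W. (cmod (x w))\<^sup>2 \<le> K * Re (sesq W g x x)"
proof -
  obtain C where C: "0 \<le> C"
    "\<And>x B w. (\<And>w. w \<in> W \<Longrightarrow> cmod (\<Sum>v\<in>W. x v * g v w) \<le> B) \<Longrightarrow> w \<in> W \<Longrightarrow> cmod (x w) \<le> C * B"
    using lower by blast
  define b where "b = 1 + (\<Sum>w\<in>W. cmod (g w w))"
  have b: "0 < b" by (simp add: b_def add_pos_nonneg sum_nonneg)
  have gb: "cmod (g w w) \<le> b" if "w \<in> W" for w
    using member_le_sum[of w W "\<lambda>w. cmod (g w w)"] W that by (simp add: b_def)
  have "(cmod (x w))\<^sup>2 \<le> ((C + 1)\<^sup>2 * b) * Re (sesq W g x x)" if w: "w \<in> W" for x w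
  proof -
    let ?B = "sqrt (b * Re (sesq W g x x))"
    have "cmod (\<Sum>v\<in>W. x v * g v w) \<le> ?B" if "w \<in> W" for w
      by (rule real_le_rsqrt) (rule semidefinite_bound[OF W that gb[OF that] b herm pos])
    then have "cmod (x w) \<le> C * ?B" using w by (rule C(2))
    also have "\<dots> \<le> (C + 1) * ?B" by (intro mult_right_mono) (simp_all add: b less_imp_le pos)
    finally have "(cmod (x w))\<^sup>2 \<le> ((C + 1) * ?B)\<^sup>2" by (intro power_mono) auto
    then show ?thesis
      using b pos[of x] by (simp add: power_mult_distrib mult.assoc)
  qed
  moreover have "0 < (C + 1)\<^sup>2 * b" using b C(1) by (simp add: add_nonneg_pos)
  ultimately show ?thesis by blast
qed

text \<open>Along a path of nondegenerate forms semidefiniteness is both an open and a closed condition.\<close>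

lemma homotopy_semidefinite:
  fixes g :: "real \<Rightarrow> 'a \<Rightarrow> 'a \<Rightarrow> complex"
  assumes W: "finite W"
    and herm: "\<And>t v w. v \<in> W \<Longrightarrow> w \<in> W \<Longrightarrow> t \<in> {0..1} \<Longrightarrow> g t w v = cnj (g t v w)"
    and cont: "\<And>v w. continuous_on {0..1} (\<lambda>t. g t v w)"
    and start: "\<And>x. 0 \<le> Re (sesq W (g 0) x x)"
    and lower: "\<And>t. t \<in> {0..1} \<Longrightarrow> \<exists>C\<ge>0. \<forall>x B.
      (\<forall>w\<in>W. cmod (\<Sum>v\<in>W. x v * g t v w) \<le> B) \<longrightarrow> (\<forall>w\<in>W. cmod (x w) \<le> C * B)"
  shows "0 \<le> Re (sesq W (g 1) x x)"
proof -
  define P where "P t \<longleftrightarrow> (\<forall>x. 0 \<le> Re (sesq W (g t) x x))" for t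
  have nbhd: "\<exists>d>0. \<forall>s\<in>{0..1}. \<bar>s - t\<bar> < d \<longrightarrow> P s = P t" if t: "t \<in> {0..1}" for t
  proof (cases "P t")
    case True
    obtain K where K: "0 < K" "\<And>x w. w \<in> W \<Longrightarrow> (cmod (x w))\<^sup>2 \<le> K * Re (sesq W (g t) x x)"
      using semidefinite_coercive[OF W herm[OF _ _ t] _ lower[OF t]] True unfolding P_def by blast
    \<comment> \<open>As \<open>(cmod (x w))\<^sup>2\<close> is at most \<open>K\<close> times the
      form, changing the entries by \<open>e\<close> changes the form by at most its own value. The
      added 1 covers an empty \<open>W\<close>.\<close>
    define e where "e = 1 / (K * (real (card W) * real (card W) + 1))"
    have e: "0 < e" using K(1) by (simp add: e_def add_nonneg_pos)
    have "\<forall>vw\<in>W \<times> W. \<exists>d>0. \<forall>s\<in>{0..1}. \<bar>s - t\<bar> < d \<longrightarrow> cmod (g s (fst vw) (snd vw) - g t (fst vw) (snd vw)) \<le> e"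
      using continuous_on_real_near[OF cont t e] by (meson less_imp_le)
    then obtain d where d: "\<And>vw. vw \<in> W \<times> W \<Longrightarrow> 0 < d vw"
      "\<And>vw s. vw \<in> W \<times> W \<Longrightarrow> s \<in> {0..1} \<Longrightarrow> \<bar>s - t\<bar> < d vw \<Longrightarrow>
        cmod (g s (fst vw) (snd vw) - g t (fst vw) (snd vw)) \<le> e"
      by metis
    define D where "D = Min (insert 1 (d ` (W \<times> W)))"
    have "0 < D" unfolding D_def using W d(1) by (subst Min_gr_iff) auto
    moreover have "P s" if s: "s \<in> {0..1}" "\<bar>s - t\<bar> < D" for s
      unfolding P_def
    proof
      fix x
      let ?Q = "Re (sesq W (g t) x x)"
      have "cmod (sesq W (\<lambda>v w. g s v w - g t v w) x x)
          \<le> real (card W) * (real (card W) * (sqrt (K * ?Q) * sqrt (K * ?Q) * e))"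
      proof (rule sesq_bound)
        fix v w assume "v \<in> W" "w \<in> W"
        moreover from this have "D \<le> d (v, w)" unfolding D_def using W by (intro Min_le) auto
        ultimately show "cmod (g s v w - g t v w) \<le> e" using d(2)[of "(v, w)" s] s by simp
      qed (auto intro: real_le_rsqrt K(2))
      also have "sqrt (K * ?Q) * sqrt (K * ?Q) = K * ?Q"
        using True K(1) by (simp add: P_def)
      also have "real (card W) * (real (card W) * (K * ?Q * e)) \<le> ?Q"
      proof -
        have "real (card W) * (real (card W) * (K * ?Q * e)) 
            = (real (card W) * real (card W) / (real (card W) * real (card W) + 1)) * ?Q"
          using K(1) by (simp add: e_def)
        also have "\<dots> \<le> 1 * ?Q"
          by (rule mult_right_mono) (use True in \<open>simp_all add: P_def divide_le_eq_1 add_pos_nonneg add_nonneg_pos\<close>)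
        finally show ?thesis by simp
      qed
      finally have "cmod (sesq W (g s) x x - sesq W (g t) x x) \<le> ?Q" by (simp add: sesq_diff)
      then show "0 \<le> Re (sesq W (g s) x x)"
        using abs_Re_le_cmod[of "sesq W (g s) x x - sesq W (g t) x x"] by simp
    qed
    ultimately show ?thesis using True by blast
  next
    case False
    then obtain x where x: "Re (sesq W (g t) x x) < 0" unfolding P_def by (auto simp: not_le)
    have cont_Re: "continuous_on {0..1} (\<lambda>s. Re (sesq W (g s) x x))"
      unfolding sesq_def by (intro continuous_intros cont)
    then obtain d where "0 < d" "\<And>s. s \<in> {0..1} \<Longrightarrow> \<bar>s - t\<bar> < d \<Longrightarrow>
        \<bar>Re (sesq W (g s) x x) - Re (sesq W (g t) x x)\<bar> < - Re (sesq W (g t) x x)"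
      using continuous_on_real_near[OF cont_Re t, of "- Re (sesq W (g t) x x)"] x
      unfolding real_norm_def by auto
    then have "\<not> P s" if "s \<in> {0..1}" "\<bar>s - t\<bar> < d" for s
      unfolding P_def using that by (smt (verit))
    then show ?thesis using False \<open>0 < d\<close> by blast
  qed
  \<comment> \<open>The Bolzano principle also asks about endpoints outside the unit interval;
    clamping moves them back without increasing the distance to \<open>t\<close>.\<close>
  define clamp where "clamp t = max 0 (min 1 t)" for t :: real
  have "P (clamp 0) = P (clamp 1)"
  proof (rule Bolzano[of 0 1 "\<lambda>a b. P (clamp a) = P (clamp b)"])
    fix t :: real assume t: "0 \<le> t" "t \<le> 1"
    have "\<exists>d>0. \<forall>s\<in>{0..1}. \<bar>s - t\<bar> < d \<longrightarrow> P s = P t" by (rule nbhd) (use t in simp)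
    then obtain d where d: "d > 0" "\<And>s. s \<in> {0..1} \<Longrightarrow> \<bar>s - t\<bar> < d \<Longrightarrow> P s = P t"
      by blast
    have "P (clamp s) = P t" if "\<bar>s - t\<bar> < d" for s
      by (rule d(2)) (use that t in \<open>auto simp: clamp_def\<close>)
    then have "P (clamp a) = P (clamp b)" if "a \<le> t" "t \<le> b" "b - a < d" for a b
      using that by simp
    then show "\<exists>d>0. \<forall>a b. a \<le> t \<and> t \<le> b \<and> b - a < d \<longrightarrow> P (clamp a) = P (clamp b)"
      using d(1) by blast
  qed auto
  then show ?thesis using start by (simp add: P_def clamp_def)
qed

section \<open>Normal ordering\<close>

definition crew :: "num list \<Rightarrow> quon" where
  "crew w = prod_list (map cre w)"

lemma crew_simps [simp]: "crew [] = 1" "crew (j # w) = cre j * crew w"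
  by (simp_all add: crew_def)

lemma scal_mult: "scal (c * d) = scal c * scal d"
  by (transfer) (simp add: fscal_def mult_single quon_rel_def quon_ideal.zero)

lemma scal_add: "scal (c + d) = scal c + scal d"
  by (transfer) (simp add: fscal_def single_add quon_rel_def quon_ideal.zero)

lemma scal_one: "scal 1 = 1"
  by (transfer) (simp add: fscal_def quon_rel_def quon_ideal.zero)

lemma scal_zero: "scal 0 = 0"
  by (transfer) (simp add: fscal_def quon_rel_def quon_ideal.zero)

lemma scal_central: "scal c * x = x * scal c"
  by (transfer) (simp add: fscal_central quon_rel_def quon_ideal.zero)

lemma scal_left_commute: "x * (scal c * y) = scal c * (x * y)"
  by (metis mult.assoc scal_central)

text \<open>Every element of the quotient is represented by a sum of scalars times products of
  letters.\<close>

lemma quon_induct [case_names scal ann cre add mult]: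
  assumes "\<And>c. P (scal c)" "\<And>i. P (ann i)" "\<And>i. P (cre i)"
    and add: "\<And>x y. P x \<Longrightarrow> P y \<Longrightarrow> P (x + y)" and mult: "\<And>x y. P x \<Longrightarrow> P y \<Longrightarrow> P (x * y)"
  shows "P x"
proof -
  have letters: "P (abs_quon (Poly_Mapping.single (Word ls) 1))" for ls
  proof (induction ls)
    case Nil
    have "Poly_Mapping.single (Word []) 1 = fscal 1"
      by (simp add: fscal_def zero_word_def)
    then show ?case using assms(1)[of 1] by (simp add: scal.abs_eq)
  next
    case (Cons l ls)
    have "Poly_Mapping.single (Word (l # ls)) (1 :: coeff) = fgen l * Poly_Mapping.single (Word ls) 1"
      by (simp add: fgen_def mult_single plus_word_def)
    moreover have "P (abs_quon (fgen l))"
      using assms(2,3) by (cases l) (simp_all add: ann.abs_eq cre.abs_eq)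
    ultimately show ?case using mult[OF _ Cons.IH] by (simp flip: times_quon.abs_eq)
  qed
  have "P (abs_quon y)" for y
  proof (induction y rule: poly_mapping_add_induct)
    case (single w c)
    have "Poly_Mapping.single w c = fscal c * Poly_Mapping.single (Word (letters w)) 1"
      by (simp add: fscal_def mult_single)
    then show ?case
      using mult[OF assms(1) letters, of c "letters w"] by (simp add: scal.abs_eq times_quon.abs_eq)
  next
    case (add p q)
    then show ?case using assms(4) by (simp flip: plus_quon.abs_eq)
  qed
  then show ?thesis by (rule quon.abs_induct)
qed

text \<open>The factor to the left of an annihilator stays arbitrary: such terms kill the vacuum, so
  only the pure creation part is made explicit.\<close>

inductive_set normal_ordered :: "quon set" where
  ann: "x * ann i \<in> normal_ordered"
| crew: "scal c * crew w \<in> normal_ordered"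
| add: "x \<in> normal_ordered \<Longrightarrow> y \<in> normal_ordered \<Longrightarrow> x + y \<in> normal_ordered"

lemma normal_ordered_scal: "x \<in> normal_ordered \<Longrightarrow> scal c * x \<in> normal_ordered"
proof (induction rule: normal_ordered.induct)
  case (ann x i)
  show ?case using normal_ordered.ann[of "scal c * x"] by (simp add: mult.assoc)
next
  case (crew d w)
  show ?case using normal_ordered.crew[of "c * d" w] by (simp add: scal_mult mult.assoc)
qed (simp add: normal_ordered.add distrib_left)

lemma normal_ordered_cre: "x \<in> normal_ordered \<Longrightarrow> cre i * x \<in> normal_ordered"
proof (induction rule: normal_ordered.induct)
  case (ann x i')
  show ?case using normal_ordered.ann[of "cre i * x"] by (simp add: mult.assoc)
next
  case (crew d w)
  have "cre i * (scal d * crew w) = scal d * crew (i # w)"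
    by (simp add: scal_left_commute)
  then show ?case by (simp add: normal_ordered.crew del: crew_simps)
qed (simp add: normal_ordered.add distrib_left)

text \<open>The relation moves the annihilator past one letter at a time; the contraction term is
  already a creation word.\<close>

lemma normal_ordered_ann_crew: "ann i * crew w \<in> normal_ordered"
proof (induction w)
  case Nil
  show ?case using normal_ordered.ann[of 1 i] by simp
next
  case (Cons j w)
  have "ann i * crew (j # w) = scal (qvar i j) * (cre j * (ann i * crew w)) + (if i = j then 1 else 0) * crew w"
    by (simp add: mult.assoc[symmetric] quon_relation distrib_right)
  also have "(if i = j then 1 else 0) * crew w = scal (if i = j then 1 else 0) * crew w"
    by (simp add: scal_one scal_zero)
  finally show ?case
    by (simp only: normal_ordered.add normal_ordered.crew normal_ordered_scal normal_ordered_cre Cons.IH)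
qed

lemma normal_ordered_ann: "x \<in> normal_ordered \<Longrightarrow> ann i * x \<in> normal_ordered"
proof (induction rule: normal_ordered.induct)
  case (ann x i')
  show ?case using normal_ordered.ann[of "ann i * x"] by (simp add: mult.assoc)
next
  case (crew d w)
  show ?case by (simp add: scal_left_commute normal_ordered_scal normal_ordered_ann_crew)
qed (simp add: normal_ordered.add distrib_left)

lemma normal_ordered_UNIV: "x \<in> normal_ordered"
proof -
  have "y \<in> normal_ordered \<Longrightarrow> x * y \<in> normal_ordered" for y
    by (induction x arbitrary: y rule: quon_induct)
      (simp_all add: normal_ordered_scal normal_ordered_ann normal_ordered_cre
        normal_ordered.add distrib_right mult.assoc)
  from this[OF normal_ordered.crew[of 1 "[]"]] show ?thesis by (simp add: scal_one)
qed

text \<open>Only the empty creation word leaves a scalar; any other term of the normal form begins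
  with a creator or ends with an annihilator. Uniqueness, on which \<open>braket\<close> also
  relies, comes from a representation in \<open>braket_eq\<close>.\<close>

lemma vacuum_expectation_exists: "\<exists>c. x - scal c \<in> vac_null"
  using normal_ordered_UNIV[of x]
proof (induction rule: normal_ordered.induct)
  case (ann x i)
  show ?case by (rule exI[of _ 0]) (simp add: scal_zero vac_null.right)
next
  case (crew c w)
  show ?case
  proof (cases w)
    case Nil
    then show ?thesis by (intro exI[of _ c]) (simp add: vac_null.zero)
  next
    case (Cons j w')
    have "scal c * crew w = cre j * (scal c * crew w')"
      by (simp add: Cons scal_left_commute)
    then show ?thesis by (intro exI[of _ 0]) (simp add: scal_zero vac_null.left)
  qed
next
  case (add x y)
  then obtain c d where "x - scal c \<in> vac_null" "y - scal d \<in> vac_null" by blast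
  then have "(x - scal c) + (y - scal d) \<in> vac_null" by (rule vac_null.add)
  then show ?case by (intro exI[of _ "c + d"]) (simp add: scal_add algebra_simps)
qed

section \<open>The Fock module\<close>

context fock_representation
begin

section \<open>Linearity of the action, sesquilinearity of the pairing and adjoints\<close>

lemma act_zero_left [simp]: "act 0 v = 0"
  using act_add_left[of 0 0 v] by simp

lemma act_zero_right [simp]: "act x 0 = 0"
  using act_add_right[of x 0 0] by simp

lemma act_one [simp]: "act 1 v = v"
  using act_scal[of 1 v] by (simp add: scal_one)

lemma act_scale: "act x (scale c v) = scale c (act x v)"
  by (simp add: scal_central flip: act_scal act_mult)

lemma act_sum: "act x (\<Sum>k\<in>K. f k) = (\<Sum>k\<in>K. act x (f k))"
  by (induction K rule: infinite_finite_induct) (simp_all add: act_add_right)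

lemma pair_zero_left [simp]: "pair 0 v = 0"
  using pair_add[of 0 0 v] by simp

lemma pair_add_right: "pair w (u + v) = pair w u + pair w v"
  by (simp only: pair_conj[of w "u + v"] pair_conj[of w u] pair_conj[of w v] pair_add qconj_add)

lemma pair_scale_right: "pair u (scale c v) = qconj c * pair u v"
  by (simp only: pair_conj[of u "scale c v"] pair_conj[of u v] pair_scale qconj_mult)

lemma pair_zero_right [simp]: "pair v 0 = 0"
  using pair_add_right[of v 0 0] by simp

lemma pair_sum_left: "pair (\<Sum>k\<in>K. f k) v = (\<Sum>k\<in>K. pair (f k) v)"
  by (induction K rule: infinite_finite_induct) (simp_all add: pair_add)

lemma pair_sum_right: "pair v (\<Sum>k\<in>K. f k) = (\<Sum>k\<in>K. pair v (f k))"
  by (induction K rule: infinite_finite_induct) (simp_all add: pair_add_right)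

text \<open>The locale provides adjointness for annihilators; Hermitian symmetry of the pairing
  gives it for creators, and sums and products follow by induction.\<close>

lemma adjoint_dag: "pair (act x u) v = pair u (act (dag x) v)"
proof (induction x arbitrary: u v rule: quon_induct)
  case (cre i)
  have "pair (act (cre i) u) v = qconj (pair v (act (cre i) u))" by (rule pair_conj)
  also have "\<dots> = qconj (pair (act (ann i) v) u)" by (simp add: adjoint)
  also have "\<dots> = pair u (act (ann i) v)" by (rule pair_conj[symmetric])
  finally show ?case by (simp add: dag_cre)
qed (simp_all add: dag_scal dag_ann dag_mult dag_add act_scal pair_scale pair_scale_right
    adjoint act_mult act_add_left pair_add pair_add_right)

lemma pair_vac_null: "x \<in> vac_null \<Longrightarrow> pair (act x vac) vac = 0"
proof (induction rule: vac_null.induct)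
  case (left i x)
  show ?case by (simp add: act_mult adjoint_dag[of "cre i"] dag_cre ann_vac)
qed (simp_all add: act_mult ann_vac act_add_left pair_add)

text \<open>The functional on the right vanishes on \<open>vac_null\<close> and returns
  \<open>c\<close> on \<open>scal c\<close>, so the scalar in the definite description is
  unique.\<close>

lemma braket_eq: "braket x = pair (act x vac) vac"
proof -
  have *: "c = pair (act x vac) vac" if "x - scal c \<in> vac_null" for c
  proof -
    have "act x vac = act (x - scal c) vac + scale c vac"
      by (simp flip: act_add_left act_scal)
    then show ?thesis using pair_vac_null[OF that] by (simp add: pair_add pair_scale pair_vac)
  qed
  obtain c where c: "x - scal c \<in> vac_null" using vacuum_expectation_exists by blast
  show ?thesis unfolding braket_def
    by (rule the_equality) (use * c in metis)+
qed

lemma pair_act_vac: "pair (act a vac) (act b vac) = braket (dag b * a)"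
  using adjoint_dag[of "dag b" "act a vac" vac] by (simp add: braket_eq act_mult dag_dag)

section \<open>Creation words on the vacuum and their pairings\<close>

abbreviation ket :: "num list \<Rightarrow> 'v" where
  "ket w \<equiv> act (crew w) vac"

lemma act_vac_expansion: "\<exists>F c. finite F \<and> act x vac = (\<Sum>w\<in>F. scale (c w) (ket w))"
  using normal_ordered_UNIV[of x]
proof (induction rule: normal_ordered.induct)
  case (ann x i)
  show ?case by (rule exI[of _ "{}"]) (simp add: act_mult ann_vac)
next
  case (crew c w)
  show ?case by (rule exI[of _ "{w}"], rule exI[of _ "\<lambda>_. c"]) (simp add: act_mult act_scal)
next
  case (add x y)
  then obtain F c G d where F: "finite F" "act x vac = (\<Sum>w\<in>F. scale (c w) (ket w))"
    and G: "finite G" "act y vac = (\<Sum>w\<in>G. scale (d w) (ket w))" by blast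
  have "act x vac = (\<Sum>w\<in>F \<union> G. scale (if w \<in> F then c w else 0) (ket w))"
    unfolding F(2) by (rule sum.mono_neutral_cong_left) (use F G in auto)
  moreover have "act y vac = (\<Sum>w\<in>F \<union> G. scale (if w \<in> G then d w else 0) (ket w))"
    unfolding G(2) by (rule sum.mono_neutral_cong_left) (use F G in auto)
  ultimately have "act (x + y) vac = (\<Sum>w\<in>F \<union> G.
      scale ((if w \<in> F then c w else 0) + (if w \<in> G then d w else 0)) (ket w))"
    by (simp add: act_add_left scale_left_distrib sum.distrib)
  then show ?case using F(1) G(1) by (intro exI conjI) (rule finite_UnI)
qed

text \<open>The annihilator moves right until it is contracted with an equal letter or reaches the
  vacuum, collecting one indeterminate for each letter passed.\<close>

lemma ann_ket: "act (ann i) (ket w) = (\<Sum>m<length w.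
  if w ! m = i then scale (\<Prod>l<m. qvar i (w ! l)) (ket (del_nth m w)) else 0)"
proof (induction w)
  case (Cons j w)
  have "act (ann i) (ket (j # w)) = act (ann i * cre j) (ket w)"
    by (simp add: act_mult)
  also have "\<dots> = (if i = j then ket w else 0) + scale (qvar i j) (act (cre j) (act (ann i) (ket w)))"
    by (simp add: quon_relation act_add_left act_mult act_scal)
  also have "scale (qvar i j) (act (cre j) (act (ann i) (ket w))) = (\<Sum>m<length w.
      if w ! m = i then scale (qvar i j * (\<Prod>l<m. qvar i (w ! l))) (ket (j # del_nth m w)) else 0)"
    unfolding Cons.IH
    by (simp add: act_sum scale_sum_right act_mult if_distrib[of "act _"] if_distrib[of "scale _"] act_scale
        cong: if_cong)
  finally show ?case
    by (simp add: sum.lessThan_Suc_shift prod.lessThan_Suc_shift del: sum.lessThan_Suc prod.lessThan_Suc cong: if_cong)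
qed (simp add: ann_vac)

text \<open>The first creator of \<open>v\<close> crosses the pairing as an annihilator, which
  reproduces the recursion of \<open>gram\<close>. Conjugation in the second slot swaps the indices
  of the collected indeterminates.\<close>

lemma pair_ket: "pair (ket v) (ket w) = gram qvar v w"
proof (induction v arbitrary: w)
  case Nil
  show ?case
  proof (cases w)
    case (Cons j w')
    then show ?thesis
      using adjoint[of j vac "ket w'"] by (simp add: act_mult ann_vac)
  qed (simp add: pair_vac)
next
  case (Cons j v)
  have prod: "qconj (\<Prod>l<m. qvar j (w ! l)) = (\<Prod>l<m. qvar (w ! l) j)" for m :: nat and w
    by (induction m) (simp_all add: qconj_mult)
  have "pair (ket (j # v)) (ket w) = pair (ket v) (act (ann j) (ket w))"
    by (simp add: act_mult adjoint_dag[of "cre j"] dag_cre)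
  then show ?case
    by (simp add: ann_ket pair_sum_right if_distrib[of "pair _"] pair_scale_right prod Cons.IH
        cong: if_cong)
qed

text \<open>The recursion treats \<open>v\<close> and \<open>w\<close> differently, so the symmetry
  is read off from the pairing of the representation, evaluated at \<open>q\<close>.\<close>

lemma gram_hermitian:
  fixes q :: "num \<Rightarrow> num \<Rightarrow> complex"
  assumes "\<And>i j. q j i = cnj (q i j)"
  shows "gram q w v = cnj (gram q v w)"
proof -
  have at: "poly_at q (pair (ket v) (ket w)) = gram q v w" for v w
    unfolding pair_ket
    by (subst gram_hom) (simp_all add: poly_at_add poly_at_mult)
  show ?thesis
    using poly_at_qconj[of q, OF assms, of "pair (ket v) (ket w)"]
    by (simp add: at pair_conj[of "ket w" "ket v", symmetric])
qed

text \<open>The path \<open>t * q\<close> stays Hermitian and inside the disc and starts at 0, where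
  the Gram form is the standard one. Semidefiniteness is carried along it, and nondegeneracy at
  \<open>t = 1\<close> makes the form definite.\<close>

lemma gram_definite:
  fixes q :: "num \<Rightarrow> num \<Rightarrow> complex"
  assumes herm: "\<And>i j. q j i = cnj (q i j)" and lt: "\<And>i j. cmod (q i j) < 1"
    and "finite F" and zero: "(\<Sum>v\<in>F. \<Sum>w\<in>F. x v * cnj (x w) * gram q v w) = 0" and "w \<in> F"
  shows "x w = 0"
proof -
  \<comment> \<open>Only finitely many letters and lengths occur in \<open>F\<close>. This gives a
    uniform bound \<open>r < 1\<close> and a finite set \<open>W\<close> of words, closed under
    rearrangement of letters, on which the lower bound is available.\<close>
  define S where "S = \<Union> (set ` F)"
  define n where "n = Max (length ` F)"
  define r where "r = Max (insert 0 ((\<lambda>(i, j). cmod (q i j)) ` (S \<times> S)))"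
  define W where "W = {w. set w \<subseteq> S \<and> length w \<le> n}"
  have S: "finite S" using \<open>finite F\<close> by (simp add: S_def)
  have W: "finite W" unfolding W_def by (rule finite_lists_length_le[OF S])
  have FW: "F \<subseteq> W" using \<open>finite F\<close> by (auto simp: W_def S_def n_def)
  have r: "r < 1" unfolding r_def using S lt by (subst Max_less_iff) auto
  have q_le: "cmod (q i j) \<le> r" if "i \<in> S" "j \<in> S" for i j
    unfolding r_def using S that by (intro Max_ge) auto
  have r0: "0 \<le> r" unfolding r_def using S by (intro Max_ge) auto
  define g where "g t = gram (\<lambda>i j. complex_of_real t * q i j)" for t
  have g_herm: "g t w v = cnj (g t v w)" for t v w
    unfolding g_def by (rule gram_hermitian) (simp flip: herm)
  have lower: "\<exists>C\<ge>0. \<forall>x B. (\<forall>w\<in>W. cmod (\<Sum>v\<in>W. x v * g t v w) \<le> B) \<longrightarrow> (\<forall>w\<in>W. cmod (x w) \<le> C * B)"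
    if "t \<in> {0..1}" for t
    unfolding W_def g_def
  proof (rule gram_lower_bound_upto[OF S r])
    fix i j assume "i \<in> S" "j \<in> S"
    then show "cmod (complex_of_real t * q i j) \<le> r"
      using that mult_mono[of t 1 "cmod (q i j)" r] q_le by (simp add: norm_mult)
  qed
  have pos: "0 \<le> Re (sesq W (g 1) y y)" for y
  proof (rule homotopy_semidefinite[OF W])
    fix x
    have "sesq W (g 0) x x = (\<Sum>v\<in>W. x v * cnj (x v))"
      by (simp add: sesq_def g_def gram_zero W if_distrib[of "(*) c" for c] cong: if_cong)
    then show "0 \<le> Re (sesq W (g 0) x x)" by (simp add: sum_nonneg)
  next
    show "continuous_on {0..1} (\<lambda>t. g t v w)" for v w
      unfolding g_def by (rule continuous_on_gram)
  qed (rule g_herm lower; assumption)+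
  obtain K where K: "\<And>x w. w \<in> W \<Longrightarrow> (cmod (x w))\<^sup>2 \<le> K * Re (sesq W (g 1) x x)"
    using semidefinite_coercive[of W "g 1", OF W g_herm pos lower] by auto
  define y where "y w = (if w \<in> F then x w else 0)" for w
  have "sesq W (g 1) y y = (\<Sum>v\<in>F. \<Sum>w\<in>W. y v * cnj (y w) * g 1 v w)"
    unfolding sesq_def by (rule sum.mono_neutral_right[OF W FW]) (simp add: y_def)
  also have "\<dots> = (\<Sum>v\<in>F. \<Sum>w\<in>F. y v * cnj (y w) * g 1 v w)"
    by (intro sum.cong refl sum.mono_neutral_right[OF W FW]) (simp add: y_def)
  also have "\<dots> = 0" using zero by (simp add: y_def g_def cong: sum.cong)
  finally have "(cmod (y w))\<^sup>2 \<le> 0" using K[of w y] \<open>w \<in> F\<close> FW by auto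
  then show ?thesis using \<open>w \<in> F\<close> by (simp add: y_def)
qed

lemma expansion_vanishes_at:
  assumes "\<And>i j. q j i = cnj (q i j)" "\<And>i j. cmod (q i j) < 1" "finite F"
    and u: "u = (\<Sum>w\<in>F. scale (c w) (ket w))" and "poly_at q (pair u u) = 0" "w \<in> F"
  shows "poly_at q (c w) = 0"
proof (rule gram_definite[of q F, OF assms(1-3) _ \<open>w \<in> F\<close>])
  have at: "poly_at q (gram qvar v w) = gram q v w" for v w
    by (subst gram_hom) (simp_all add: poly_at_add poly_at_mult)
  have "poly_at q (pair u u) = (\<Sum>v\<in>F. \<Sum>w\<in>F. poly_at q (c v) * cnj (poly_at q (c w)) * gram q v w)"
    unfolding u
    by (simp add: pair_sum_left pair_sum_right pair_scale pair_scale_right pair_ket poly_at_sum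
        poly_at_mult poly_at_qconj[of q, OF assms(1)] at sum_distrib_left mult.left_commute)
      (subst sum.swap, simp add: mult.assoc)
  then show "(\<Sum>v\<in>F. \<Sum>w\<in>F. poly_at q (c v) * cnj (poly_at q (c w)) * gram q v w) = 0"
    using assms(5) by simp
qed

text \<open>Here \<open>q\<close> ranges over all Hermitian points in the disc: coefficients that
  vanish at each of them are zero polynomials.\<close>

lemma pair_definite:
  assumes "pair (act x vac) (act x vac) = 0"
  shows "act x vac = 0"
proof -
  obtain F c where F: "finite F" "act x vac = (\<Sum>w\<in>F. scale (c w) (ket w))"
    using act_vac_expansion by blast
  have "c w = 0" if "w \<in> F" for w
  proof (rule poly_zero_if_vanishes)
    fix q assume "q \<in> hermitian_params"
    then have "q j i = cnj (q i j)" "cmod (q i j) < 1" for i j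
      by (simp_all add: hermitian_params_def)
    then show "poly_at q (c w) = 0"
      by (rule expansion_vanishes_at[of q, OF _ _ F _ that]) (simp add: assms)
  qed
  then show ?thesis using F by simp
qed

text \<open>At a single point the coefficients are only known to vanish there, which places the
  vector in \<open>zero_at\<close> instead of making it zero.\<close>

lemma pair_definite_at:
  assumes "\<And>i j. q j i = cnj (q i j)" "\<And>i j. cmod (q i j) < 1"
    and "poly_at q (pair (act x vac) (act x vac)) = 0"
  shows "act x vac \<in> zero_at scale {act a vac | a. True} q"
proof -
  obtain F c where F: "finite F" "act x vac = (\<Sum>w\<in>F. scale (c w) (ket w))"
    using act_vac_expansion by blast
  have "poly_at q (c w) = 0" if "w \<in> F" for w
    by (rule expansion_vanishes_at[of q, OF assms(1,2) F assms(3) that])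
  then show ?thesis
    unfolding F(2) zero_at_def by (intro span_sum span_base) auto
qed

lemma indefinite_hilbert_module_pair:
  "indefinite_hilbert_module scale {act a vac | a. True} pair"
proof -
  let ?H = "{act a vac | a. True}"
  have "subspace ?H"
  proof (rule subspaceI)
    show "0 \<in> ?H" by (intro CollectI exI[of _ 0]) simp
    show "u + v \<in> ?H" if "u \<in> ?H" "v \<in> ?H" for u v
      using that act_add_left[symmetric] by auto
    show "scale c u \<in> ?H" if "u \<in> ?H" for c u
      using that by (auto simp flip: act_scal act_mult)
  qed
  moreover have "indefinite_inner_product scale ?H pair"
    unfolding indefinite_inner_product_def
  proof (intro conjI allI ballI impI)
    show "pair u v = qconj (pair v u)" for u v by (rule pair_conj)
    show "pair u u \<noteq> 0" if "u \<in> ?H" "u \<noteq> 0" for u using that pair_definite by auto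
  qed (simp_all add: pair_scale pair_add)
  ultimately show ?thesis
    by (simp add: indefinite_hilbert_module_def module_axioms)
qed

end

theorem theorem1p3:
  fixes scale :: "coeff \<Rightarrow> 'v::ab_group_add \<Rightarrow> 'v"
    and act :: "quon \<Rightarrow> 'v \<Rightarrow> 'v"
    and pair :: "'v \<Rightarrow> 'v \<Rightarrow> coeff"
    and vac :: 'v
    and H :: "'v set"
    and q :: "num \<Rightarrow> num \<Rightarrow> complex"
  assumes fock: "fock_representation scale act pair vac"
    and H: "H = {act a vac | a. True}"
    and q: "\<And>i j. cmod (q i j) < 1"
  shows "\<exists>ip.
    (\<forall>\<mu> \<nu> a b. ip (scale \<mu> (act a vac)) (scale \<nu> (act b vac))
        = \<mu> * qconj \<nu> * braket (dag b * a)) \<and>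
    indefinite_hilbert_module scale H ip \<and>
    ((\<forall>i j. q j i = cnj (q i j)) \<longrightarrow>
      (\<forall>u\<in>H. u \<notin> zero_at scale H q \<longrightarrow> poly_at q (ip u u) \<noteq> 0))"
proof (intro exI[of _ pair] conjI allI impI ballI)
  interpret fock_representation scale act pair vac by (rule fock)
  \<comment> \<open>With the given pairing as witness, the bra-ket formula is independent of the
    representatives \<open>a\<close> and \<open>b\<close>.\<close>
  show "pair (scale \<mu> (act a vac)) (scale \<nu> (act b vac)) = \<mu> * qconj \<nu> * braket (dag b * a)" for \<mu> \<nu> a b
    by (simp add: pair_scale pair_scale_right pair_act_vac mult.assoc)
  show "indefinite_hilbert_module scale H pair"
    unfolding H by (rule indefinite_hilbert_module_pair)
  fix u assume "\<forall>i j. q j i = cnj (q i j)" "u \<in> H" "u \<notin> zero_at scale H q"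
  then show "poly_at q (pair u u) \<noteq> 0"
    using pair_definite_at[of q] q unfolding H by blast
qed

end
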